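(* Let $F_H$ be an affine and linear invariant family of (normalized) sense-preserving harmonic mappings in the unit disk $\mathbb{D}$, and let $F_H^0=\{f=h+\overline{g}\in F_H : g'(0)=0\}$. Assume that there is a function $f_0=h_0+\overline{g_0}\in F_H^0$ such that $$\sup_{f=h+\overline g\in F_H^0} \mathrm{Re}\,\{a_n(h)\}=a_n(h_0)\quad\text{and}\quad \sup_{f=h+\overline g\in F_H^0} \mathrm{Re}\,\{b_n(g)\}=b_n(g_0)$$ for all $n\geq 2$. Then there exist a real number $a$ and a number $R\in[0,1]$ such that $f_0=K_{a,R}$, the generalized harmonic Koebe function with parameters $a$ and $R$. Moreover, the order of $F_H$ equals $\alpha(F_H)=a+R$.
   Context: $\mathbb{D}$ is the open unit disk. Every complex-valued harmonic function $f$ in $\mathbb{D}$ is written $f=h+\overline g$ with $h,g$ analytic in $\mathbb{D}$ and $g(0)=0$; $a_n(h)$ and $b_n(g)$ denote the $n$-th Taylor coefficients at $0$ of $h$ and $g$ respectively. $f=h+\overline g$ is sense-preserving if $h'$ does not vanish in $\mathbb{D}$ and the dilatation $\omega=g'/h'$ satisfies $|\omega|<1$ in $\mathbb{D}$. An affine and linear invariant family $F_H$ is a family of sense-preserving harmonic mappings $f=h+\overline g$ in $\mathbb{D}$, normalized by $h(0)=g(0)=0$, $h'(0)=1$, which is closed under the Koebe transforms $$K_{\zeta}(f)(z)=\frac{f\left(\frac{z+\zeta}{1+\overline{\zeta} z}\right)-f(\zeta)}{(1-|\zeta|^2)h'(\zeta)},\quad |\zeta|<1,$$ and the affine changes $$A_\varepsilon(f)(z)=\frac{f(z)-\overline{\varepsilon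 f(z)}}{1-\overline\varepsilon g'(0)},\quad |\varepsilon|<1.$$ Its order is $\alpha(F_H)=\sup_{f=h+\overline g\in F_H}|a_2(h)|$. Generalized (analytic) Koebe functions: for $a\neq 0$, $k_a(z)=\frac{1}{2a}\left[\left(\frac{1+z}{1-z}\right)^a-1\right]$, and $k_0(z)=\frac12\log\frac{1+z}{1-z}$, $z\in\mathbb{D}$ (branch of the logarithm with $\log 1=0$). Lens maps: $l_0\equiv 0$, $l_1(z)=z$, and for $0<R<1$, $l_R(z)=\dfrac{\left(\frac{1+z}{1-z}\right)^R-1}{\left(\frac{1+z}{1-z}\right)^R+1}$. For real $a$ and $0\le R\le 1$, the generalized harmonic Koebe function $K_{a,R}$ is $K_{a,R}=h+\overline g$, where $h,g$ are the analytic functions in $\mathbb{D}$ with $h-g=k_a$, $g'/h'=l_R$, $h(0)=g(0)=0$. *)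

theory Defs
  imports "HOL-Complex_Analysis.Complex_Analysis"
begin

abbreviation unit_disk :: "complex set" where
  "unit_disk \<equiv> ball 0 1"

(* Functions on the disk are total functions whose values off the disk are irrelevant:
   every condition below constrains them on the disk only. *)

(* f = h + cnj g is the canonical representation of the harmonic function f; the
   normalization g 0 = 0 makes h and g unique on the disk. *)
definition harmonic_repr ::
  "(complex \<Rightarrow> complex) \<Rightarrow> (complex \<Rightarrow> complex) \<Rightarrow> (complex \<Rightarrow> complex) \<Rightarrow> bool" where
  "harmonic_repr f h g \<longleftrightarrow>
     h holomorphic_on unit_disk \<and> g holomorphic_on unit_disk \<and> g 0 = 0 \<and>
     (\<forall>z\<in>unit_disk. f z = h z + cnj (g z))"

definition sense_preserving :: "(complex \<Rightarrow> complex) \<Rightarrow> (complex \<Rightarrow> complex) \<Rightarrow> bool" where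
  "sense_preserving h g \<longleftrightarrow>
     (\<forall>z\<in>unit_disk. deriv h z \<noteq> 0 \<and> norm (deriv g z / deriv h z) < 1)"

definition taylor_coeff :: "(complex \<Rightarrow> complex) \<Rightarrow> nat \<Rightarrow> complex" where
  "taylor_coeff h n = (deriv ^^ n) h 0 / fact n"

(* In the next two definitions h and g stand for the parts of f = h + cnj g. *)
definition koebe_transform ::
  "complex \<Rightarrow> (complex \<Rightarrow> complex) \<Rightarrow> (complex \<Rightarrow> complex) \<Rightarrow> complex \<Rightarrow> complex" where
  "koebe_transform \<zeta> f h z =
     (f ((z + \<zeta>) / (1 + cnj \<zeta> * z)) - f \<zeta>) / (complex_of_real (1 - (norm \<zeta>)\<^sup>2) * deriv h \<zeta>)"

definition affine_change ::
  "complex \<Rightarrow> (complex \<Rightarrow> complex) \<Rightarrow> (complex \<Rightarrow> complex) \<Rightarrow> complex \<Rightarrow> complex" where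
  "affine_change \<epsilon> f g z = (f z - cnj (\<epsilon> * f z)) / (1 - cnj \<epsilon> * deriv g 0)"

definition affine_linear_invariant :: "(complex \<Rightarrow> complex) set \<Rightarrow> bool" where
  "affine_linear_invariant F \<longleftrightarrow>
     (\<forall>f\<in>F. \<exists>h g. harmonic_repr f h g \<and> sense_preserving h g \<and> h 0 = 0 \<and> deriv h 0 = 1) \<and>
     (\<forall>f\<in>F. \<forall>h g \<zeta>. harmonic_repr f h g \<and> norm \<zeta> < 1 \<longrightarrow>
        (\<exists>k\<in>F. \<forall>z\<in>unit_disk. k z = koebe_transform \<zeta> f h z)) \<and>
     (\<forall>f\<in>F. \<forall>h g \<epsilon>. harmonic_repr f h g \<and> norm \<epsilon> < 1 \<longrightarrow>
        (\<exists>k\<in>F. \<forall>z\<in>unit_disk. k z = affine_change \<epsilon> f g z))"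

definition zero_subfamily :: "(complex \<Rightarrow> complex) set \<Rightarrow> (complex \<Rightarrow> complex) set" where
  "zero_subfamily F = {f \<in> F. \<exists>h g. harmonic_repr f h g \<and> deriv g 0 = 0}"

definition harmonic_parts ::
  "(complex \<Rightarrow> complex) set \<Rightarrow> ((complex \<Rightarrow> complex) \<times> (complex \<Rightarrow> complex)) set" where
  "harmonic_parts F = {(h, g). \<exists>f\<in>F. harmonic_repr f h g}"

(* Suprema are taken in ereal, since Sup on real is unspecified for unbounded sets. *)
definition family_order :: "(complex \<Rightarrow> complex) set \<Rightarrow> ereal" where
  "family_order F = (SUP (h, g) \<in> harmonic_parts F. ereal (norm (taylor_coeff h 2)))"

(* (1 + z) / (1 - z) has positive real part on the disk, so the principal branches used
   by Ln and powr are the branches with value 0 resp. 1 at z = 0. *)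
definition gen_koebe :: "complex \<Rightarrow> complex \<Rightarrow> complex" where
  "gen_koebe a z =
     (if a = 0 then 1 / 2 * Ln ((1 + z) / (1 - z))
      else 1 / (2 * a) * (((1 + z) / (1 - z)) powr a - 1))"

definition lens_map :: "real \<Rightarrow> complex \<Rightarrow> complex" where
  "lens_map R z =
     (if R = 0 then 0
      else if R = 1 then z
      else (((1 + z) / (1 - z)) powr (of_real R) - 1) / (((1 + z) / (1 - z)) powr (of_real R) + 1))"

(* f = K_{a,R} on the disk.  The conditions determine h and g, hence f, on the disk. *)
definition is_gen_harmonic_koebe :: "real \<Rightarrow> real \<Rightarrow> (complex \<Rightarrow> complex) \<Rightarrow> bool" where
  "is_gen_harmonic_koebe a R f \<longleftrightarrow>
     (\<exists>h g. h holomorphic_on unit_disk \<and> g holomorphic_on unit_disk \<and> h 0 = 0 \<and> g 0 = 0 \<and>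
        (\<forall>z\<in>unit_disk. h z - g z = gen_koebe (of_real a) z) \<and>
        (\<forall>z\<in>unit_disk. deriv h z \<noteq> 0 \<and> deriv g z / deriv h z = lens_map R z) \<and>
        (\<forall>z\<in>unit_disk. f z = h z + cnj (g z)))"

end

theory Submission
  imports Defs
begin

text \<open>
  The coefficient problem is attacked with Marty's variation. Applying to \<open>f\<^sub>0\<close> the Koebe
  transform with small real parameter \<open>t\<close>, followed by the affine change leading back to
  the subfamily \<open>g'(0) = 0\<close>, gives admissible competitors whose coefficients have a local
  maximum at \<open>t = 0\<close>. The vanishing of all the \<open>t\<close>-derivatives says exactly that
  \<open>(1 - z\<^sup>2) h\<^sub>0' = 1 + 2 A h\<^sub>0 + 2 B g\<^sub>0\<close> and \<open>(1 - z\<^sup>2) g\<^sub>0' = 2 A g\<^sub>0 + 2 B h\<^sub>0\<close>,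
  where \<open>A\<close> and \<open>B\<close> are the second coefficients of \<open>h\<^sub>0\<close> and \<open>g\<^sub>0\<close>. The system decouples for
  \<open>h\<^sub>0 - g\<^sub>0\<close> and \<open>h\<^sub>0 + g\<^sub>0\<close>, and yields \<open>f\<^sub>0 = K\<^bsub>a,R\<^esub>\<close> with \<open>a = A - B\<close> and \<open>R = 2 B\<close>.

  Compositions of disk automorphisms of Koebe type give all rotations. Hence \<open>B \<ge> 0\<close>, and
  \<open>A\<close>, \<open>B\<close> bound the moduli of the second coefficients in the subfamily. Undoing the affine
  normalization bounds \<open>\<bar>a\<^sub>2\<bar>\<close> by \<open>A + B\<close> in the whole family; the affine changes of
  \<open>f\<^sub>0\<close> with \<open>\<epsilon> \<rightarrow> -1\<close> show that this is sharp. Finally \<open>R \<le> 1\<close>, because otherwise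
  the dilatation would have modulus \<open>1\<close> at a point of the disk.
\<close>

subsection \<open>Taylor coefficients\<close>

lemma taylor_coeff_eqI: "f has_fps_expansion A \<Longrightarrow> taylor_coeff f n = fps_nth A n"
  by (simp add: taylor_coeff_def fps_nth_fps_expansion)

lemma has_fps_expansion_taylor:
  assumes "f holomorphic_on ball 0 r" "r > 0"
  shows "f has_fps_expansion Abs_fps (taylor_coeff f)"
  using has_fps_expansion_fps_expansion[OF open_ball _ assms(1)] assms(2)
  by (simp add: fps_expansion_def taylor_coeff_def[abs_def])

lemma taylor_coeff_0: "taylor_coeff f 0 = f 0"
  by (simp add: taylor_coeff_def)

lemma taylor_coeff_1: "taylor_coeff f (Suc 0) = deriv f 0"
  by (simp add: taylor_coeff_def)

lemma taylor_coeff_linear: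
  assumes "f holomorphic_on ball 0 r" "g holomorphic_on ball 0 r" "r > 0"
  shows "taylor_coeff (\<lambda>z. a * f z + b * g z) n = a * taylor_coeff f n + b * taylor_coeff g n"
proof -
  have "(\<lambda>z. a * f z + b * g z) has_fps_expansion
      fps_const a * Abs_fps (taylor_coeff f) + fps_const b * Abs_fps (taylor_coeff g)"
    using assms by (intro fps_expansion_intros has_fps_expansion_taylor)
  from taylor_coeff_eqI[OF this] show ?thesis by simp
qed

lemma taylor_coeff_affine:
  assumes "f holomorphic_on ball 0 r" "r > 0" "n > 0"
  shows "taylor_coeff (\<lambda>z. (f z - b) / c) n = taylor_coeff f n / c"
proof -
  have "taylor_coeff (\<lambda>z. (1/c) * f z + (- b / c) * 1) n =
     (1/c) * taylor_coeff f n + (- b / c) * taylor_coeff (\<lambda>_. 1) n"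
    using assms by (intro taylor_coeff_linear) auto
  moreover have "taylor_coeff (\<lambda>_. 1) n = 0"
    using \<open>n > 0\<close> taylor_coeff_eqI[OF has_fps_expansion_1, of n] by simp
  ultimately show ?thesis by (simp add: diff_divide_distrib)
qed

lemma taylor_coeff_rotate:
  assumes "f holomorphic_on ball 0 r" "r > 0"
  shows "taylor_coeff (\<lambda>z. f (u * z)) n = u ^ n * taylor_coeff f n"
proof (cases "u = 0")
  case True
  then show ?thesis
    using taylor_coeff_eqI[OF has_fps_expansion_const, of "f 0" n] 
    by (cases n) (auto simp: taylor_coeff_0)
next
  case False
  have "(\<lambda>z. f (u * z)) has_fps_expansion fps_compose (Abs_fps (taylor_coeff f)) (fps_const u * fps_X)"
    using has_fps_expansion_compose[OF has_fps_expansion_taylor[OF assms]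
        has_fps_expansion_mult[OF has_fps_expansion_const has_fps_expansion_fps_X]]
    by (simp add: o_def)
  from taylor_coeff_eqI[OF this] show ?thesis by (simp add: fps_compose_linear)
qed

text \<open>One formula serves every \<open>n\<close>: truncated subtraction makes the factor
  \<open>of_nat (n - 1)\<close> vanish for \<open>n = 0\<close> and \<open>n = 1\<close>, exactly
  where the product with z^2 contributes nothing.\<close>

lemma taylor_coeff_koebe_deriv:
  assumes "f holomorphic_on ball 0 r" "r > 0"
  shows "taylor_coeff (\<lambda>z. (1 - z\<^sup>2) * deriv f z) n =
     of_nat (Suc n) * taylor_coeff f (Suc n) - of_nat (n - 1) * taylor_coeff f (n - 1)"
proof -
  have "(\<lambda>z. (1 - z\<^sup>2) * deriv f z) has_fps_expansion
      (1 - fps_X ^ 2) * fps_deriv (Abs_fps (taylor_coeff f))"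
    using assms by (intro fps_expansion_intros has_fps_expansion_taylor)
  from taylor_coeff_eqI[OF this, of n]
  have eq: "taylor_coeff (\<lambda>z. (1 - z\<^sup>2) * deriv f z) n =
      of_nat (Suc n) * taylor_coeff f (Suc n) -
      (if n < 2 then 0 else of_nat (Suc (n - 2)) * taylor_coeff f (Suc (n - 2)))"
    by (simp only: left_diff_distrib mult_1 fps_sub_nth fps_X_power_mult_nth fps_deriv_nth
        Abs_fps_inverse fps_nth_Abs_fps Suc_eq_plus1)
  show ?thesis
  proof (cases "n < 2")
    case True
    then have "n - 1 = 0" by simp
    with True eq show ?thesis by simp
  next
    case False
    then have "Suc (n - 2) = n - 1" by simp
    with False eq show ?thesis by simp
  qed
qed

lemma holomorphic_eq_taylor:
  assumes "f holomorphic_on ball 0 r" "g holomorphic_on ball 0 r" "z \<in> ball 0 r"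
    and "\<And>n. taylor_coeff f n = taylor_coeff g n"
  shows "f z = g z"
  using assms by (intro holomorphic_fun_eq_on_ball[of f 0 r g]) (auto simp: taylor_coeff_def)

text \<open>Every term of the power series is real. Applied to the derivatives of the extremal pair,
  this removes the conjugations from transforms with a real parameter.\<close>

lemma holomorphic_real_on_real_axis:
  assumes "f holomorphic_on ball 0 r" "\<And>n. taylor_coeff f n \<in> \<real>" "z \<in> \<real>" "z \<in> ball 0 r"
  shows "f z \<in> \<real>"
proof -
  have "(\<lambda>n. taylor_coeff f n * z ^ n) sums f z"
    using holomorphic_power_series[OF assms(1,4)] by (simp add: taylor_coeff_def)
  then have "(\<lambda>n. Im (taylor_coeff f n * z ^ n)) sums Im (f z)" by (rule sums_Im)
  moreover have "Im (taylor_coeff f n * z ^ n) = 0" for n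
    using assms by (metis Reals_mult Reals_power complex_is_Real_iff)
  ultimately have "Im (f z) = 0" by (simp add: sums_iff)
  then show ?thesis by (simp add: complex_is_Real_iff)
qed

text \<open>The difference quotients in \<open>t\<close> converge to \<open>D 0\<close> uniformly on
  a smaller disk, because \<open>D\<close> is uniformly continuous on compact sets; higher
  derivatives at 0 pass to uniform limits of holomorphic functions.\<close>

lemma taylor_coeff_parametric_deriv:
  fixes G D :: "complex \<Rightarrow> complex \<Rightarrow> complex"
  assumes "r > 0" "s > 0"
    and der: "\<And>t z. t \<in> ball 0 r \<Longrightarrow> z \<in> ball 0 s \<Longrightarrow>
      ((\<lambda>t. G t z) has_field_derivative D t z) (at t)"
    and cont: "continuous_on (ball 0 r \<times> ball 0 s) (\<lambda>(t, z). D t z)"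
    and holo: "\<And>t. t \<in> ball 0 r \<Longrightarrow> G t holomorphic_on ball 0 s"
  shows "((\<lambda>t. taylor_coeff (G t) n) has_field_derivative taylor_coeff (D 0) n) (at 0)"
proof -
  define K where "K = cball (0::complex) (r/2) \<times> cball (0::complex) (s/2)"
  have "K \<subseteq> ball 0 r \<times> ball 0 s" using assms(1,2) by (auto simp: K_def)
  then have "uniformly_continuous_on K (\<lambda>(t, z). D t z)"
    using cont continuous_on_subset by (intro compact_uniformly_continuous) 
      (auto simp: K_def intro!: compact_Times)
  note unif = this[unfolded uniformly_continuous_on_def, rule_format]
  define A where "A = ball (0::complex) (s/2)"
  define Q where "Q = (\<lambda>t z. (1/t) * G t z + (- (1/t)) * G 0 z)"
  have "uniform_limit A Q (D 0) (at 0)"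
    unfolding uniform_limit_iff
  proof (intro allI impI)
    fix e :: real assume "e > 0"
    then obtain d where d: "d > 0"
      "\<And>x x'. x \<in> K \<Longrightarrow> x' \<in> K \<Longrightarrow> dist x' x < d \<Longrightarrow> dist (case x' of (t, z) \<Rightarrow> D t z) (case x of (t, z) \<Rightarrow> D t z) < e/2"
      using unif[of "e/2"] by (metis half_gt_zero)
    have "dist (Q t z) (D 0 z) < e" if t: "t \<noteq> 0" "norm t < min d (r/2)" and z: "z \<in> A" for t z
    proof -
      \<comment> \<open>Mean value inequality in \<open>t\<close>: once the linear term
        \<open>t * D 0 z\<close> is subtracted, the derivative is \<open>D u z - D 0 z\<close>,
        which uniform continuity keeps below \<open>e/2\<close>.\<close>
      have "norm ((G t z - t * D 0 z) - (G 0 z - 0 * D 0 z)) \<le> e/2 * norm (t - 0)"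
      proof (rule field_differentiable_bound[where S="cball 0 (norm t)" and f'="\<lambda>u. D u z - D 0 z"])
        fix u :: complex assume u: "u \<in> cball 0 (norm t)"
        then have "norm u \<le> norm t" by simp
        then have "u \<in> ball 0 r" using t \<open>r > 0\<close> by auto
        moreover have "z \<in> ball 0 s" using z \<open>s > 0\<close> by (auto simp: A_def)
        ultimately show "((\<lambda>t. G t z - t * D 0 z) has_field_derivative D u z - D 0 z) (at u within cball 0 (norm t))"
          by (auto intro!: derivative_eq_intros DERIV_subset[OF der])
        have "dist (D u z) (D 0 z) < e/2"
          using d(2)[of "(0, z)" "(u, z)"] u t z \<open>r > 0\<close> by (auto simp: K_def A_def dist_Pair_Pair)
        then show "norm (D u z - D 0 z) \<le> e/2" by (simp add: dist_norm)
      qed auto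
      then have "norm (t * (Q t z - D 0 z)) \<le> e/2 * norm t"
        using t by (simp add: Q_def algebra_simps)
      then have "norm (Q t z - D 0 z) \<le> e/2" using t by (simp add: norm_mult)
      then show ?thesis using \<open>e > 0\<close> by (simp add: dist_norm)
    qed
    then show "\<forall>\<^sub>F t in at 0. \<forall>z\<in>A. dist (Q t z) (D 0 z) < e"
      unfolding eventually_at using d(1) \<open>r > 0\<close> by (intro exI[of _ "min d (r/2)"]) auto
  qed
  moreover have ev: "\<forall>\<^sub>F t in at 0. t \<in> ball 0 r"
    using \<open>r > 0\<close> by (intro eventually_at_in_open') auto
  have GA: "G t holomorphic_on A" if "t \<in> ball 0 r" for t
    using holo[OF that] by (rule holomorphic_on_subset) (use \<open>s > 0\<close> in \<open>auto simp: A_def\<close>)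
  have "\<forall>\<^sub>F t in at 0. Q t holomorphic_on A"
    using ev by eventually_elim (use \<open>r > 0\<close> in \<open>auto simp: Q_def intro!: holomorphic_intros GA\<close>)
  ultimately have "((\<lambda>t. (deriv ^^ n) (Q t) 0) \<longlongrightarrow> (deriv ^^ n) (D 0) 0) (at 0)"
    by (rule higher_deriv_complex_uniform_limit) (use \<open>s > 0\<close> in \<open>auto simp: A_def\<close>)
  then have "((\<lambda>t. taylor_coeff (Q t) n) \<longlongrightarrow> taylor_coeff (D 0) n) (at 0)"
    unfolding taylor_coeff_def by (intro tendsto_intros) auto
  moreover have "\<forall>\<^sub>F t in at 0. taylor_coeff (Q t) n = (taylor_coeff (G t) n - taylor_coeff (G 0) n) / t"
    using ev 
  proof eventually_elim
    case (elim t)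
    have "taylor_coeff (Q t) n = (1/t) * taylor_coeff (G t) n + (- (1/t)) * taylor_coeff (G 0) n"
      unfolding Q_def using GA[of t] GA[of 0] elim assms(1,2)
      by (intro taylor_coeff_linear[where r="s/2"]) (auto simp: A_def)
    then show ?case by (simp add: diff_divide_distrib)
  qed
  ultimately have "((\<lambda>t. (taylor_coeff (G t) n - taylor_coeff (G 0) n) / t) \<longlongrightarrow> taylor_coeff (D 0) n) (at 0)"
    by (rule Lim_transform_eventually)
  then show ?thesis by (simp add: DERIV_def)
qed

subsection \<open>Koebe transforms and affine changes of harmonic pairs\<close>

text \<open>The real differential of \<open>u\<close> is complex linear and conjugate linear at
  once; its values at 1 and at the imaginary unit then force it to vanish.\<close>

lemma holomorphic_eq_cnj_imp_deriv_zero: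
  assumes "open S" "u holomorphic_on S" "v holomorphic_on S"
    and eq: "\<And>z. z \<in> S \<Longrightarrow> u z = cnj (v z)" and z: "z \<in> S"
  shows "deriv u z = 0"
proof -
  have u: "(u has_derivative (\<lambda>x. deriv u z * x)) (at z)"
    using holomorphic_derivI[OF assms(2,1) z] by (simp add: has_field_derivative_def)
  have "(v has_derivative (\<lambda>x. deriv v z * x)) (at z)"
    using holomorphic_derivI[OF assms(3,1) z] by (simp add: has_field_derivative_def)
  then have "((\<lambda>z. cnj (v z)) has_derivative (\<lambda>x. cnj (deriv v z * x))) (at z)"
    by (rule bounded_linear.has_derivative[OF bounded_linear_cnj])
  then have "(u has_derivative (\<lambda>x. cnj (deriv v z * x))) (at z)"
    by (rule has_derivative_transform_within_open[OF _ assms(1) z]) (simp add: eq)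
  from has_derivative_unique[OF u this]
  have "deriv u z * x = cnj (deriv v z * x)" for x by metis
  from this[of 1] this[of \<i>] show ?thesis by auto
qed

text \<open>The difference of the analytic parts is also the conjugate of a holomorphic function,
  hence constant; the normalization of \<open>g\<close> and \<open>g'\<close> at 0 makes this
  constant zero.\<close>

lemma harmonic_repr_unique:
  assumes "harmonic_repr f h g" "harmonic_repr f h' g'" "z \<in> unit_disk"
  shows "h z = h' z" "g z = g' z"
proof -
  define u where "u = (\<lambda>z. h z - h' z)"
  have hol: "h holomorphic_on unit_disk" "g holomorphic_on unit_disk"
    "h' holomorphic_on unit_disk" "g' holomorphic_on unit_disk"
    using assms by (auto simp: harmonic_repr_def)
  then have u: "u holomorphic_on unit_disk" by (auto simp: u_def intro!: holomorphic_intros)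
  have eq: "u z = cnj (g' z - g z)" if "z \<in> unit_disk" for z
  proof -
    have "h z + cnj (g z) = h' z + cnj (g' z)"
      using assms(1,2) that unfolding harmonic_repr_def by metis
    then show ?thesis by (simp add: u_def complex_eq_iff)
  qed
  have "deriv u z = 0" if "z \<in> unit_disk" for z
  proof (rule holomorphic_eq_cnj_imp_deriv_zero[OF open_ball u _ eq that])
    show "(\<lambda>z. g' z - g z) holomorphic_on unit_disk" by (intro holomorphic_intros hol)
  qed auto
  then have "(u has_field_derivative 0) (at z within unit_disk)" if "z \<in> unit_disk" for z
    using holomorphic_derivI[OF u open_ball that] that by (metis DERIV_subset subset_UNIV)
  then obtain c where "\<And>z. z \<in> unit_disk \<Longrightarrow> u z = c"
    using has_field_derivative_zero_constant[of unit_disk u] by auto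
  moreover have "u 0 = 0" using eq[of 0] assms(1,2) by (simp add: harmonic_repr_def)
  ultimately have "u z = 0" using assms(3) by force
  then show "h z = h' z" "g z = g' z" using eq[OF assms(3)] by (auto simp: u_def)
qed

lemma harmonic_parts_cong:
  assumes "(h, g) \<in> harmonic_parts F"
    and "\<And>z. z \<in> unit_disk \<Longrightarrow> h z = h' z" "\<And>z. z \<in> unit_disk \<Longrightarrow> g z = g' z"
  shows "(h', g') \<in> harmonic_parts F"
proof -
  have "h' holomorphic_on unit_disk" if "h holomorphic_on unit_disk"
    using that assms(2) holomorphic_cong[of unit_disk unit_disk h h'] by simp
  moreover have "g' holomorphic_on unit_disk" if "g holomorphic_on unit_disk"
    using that assms(3) holomorphic_cong[of unit_disk unit_disk g g'] by simp
  moreover have "g' 0 = g 0" using assms(3)[of 0] by simp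
  ultimately show ?thesis
    using assms unfolding harmonic_parts_def harmonic_repr_def by fastforce
qed

text \<open>Membership in \<open>F\<close> supplies only some normalized representation; uniqueness
  carries its properties over to the given pair.\<close>

lemma harmonic_partsD:
  assumes "affine_linear_invariant F" "(h, g) \<in> harmonic_parts F"
  shows "h holomorphic_on unit_disk" "g holomorphic_on unit_disk" "h 0 = 0" "g 0 = 0"
    "deriv h 0 = 1" "sense_preserving h g"
proof -
  obtain f where f: "f \<in> F" "harmonic_repr f h g"
    using assms(2) by (auto simp: harmonic_parts_def)
  then show "h holomorphic_on unit_disk" "g holomorphic_on unit_disk" "g 0 = 0"
    by (auto simp: harmonic_repr_def)
  obtain h' g' where h': "harmonic_repr f h' g'" "sense_preserving h' g'" "h' 0 = 0" "deriv h' 0 = 1"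
    using assms(1) f(1) by (auto simp: affine_linear_invariant_def)
  note eq = harmonic_repr_unique[OF f(2) h'(1)]
  show "h 0 = 0" using h'(3) eq by simp
  have "deriv h z = deriv h' z" "deriv g z = deriv g' z" if "z \<in> unit_disk" for z
    using eq eventually_nhds_in_open[OF open_ball that] by (auto intro!: deriv_cong_ev elim: eventually_mono)
  then show "deriv h 0 = 1" "sense_preserving h g" using h' by (auto simp: sense_preserving_def)
qed

text \<open>For \<open>f = h + cnj g\<close> the numerator \<open>f - cnj (\<epsilon> * f)\<close>
  splits into \<open>h - cnj \<epsilon> * g\<close> and the conjugate of
  \<open>g - \<epsilon> * h\<close>. The denominator is therefore conjugated in the coanalytic
  part.\<close>

lemma harmonic_parts_affine_change:
  assumes F: "affine_linear_invariant F" and hg: "(h, g) \<in> harmonic_parts F" and "norm \<epsilon> < 1"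
  shows "(\<lambda>z. (h z - cnj \<epsilon> * g z) / (1 - cnj \<epsilon> * deriv g 0),
          \<lambda>z. (g z - \<epsilon> * h z) / cnj (1 - cnj \<epsilon> * deriv g 0)) \<in> harmonic_parts F"
proof -
  obtain f where f: "f \<in> F" "harmonic_repr f h g"
    using hg by (auto simp: harmonic_parts_def)
  then have "\<exists>k\<in>F. \<forall>z\<in>unit_disk. k z = affine_change \<epsilon> f g z"
    using F \<open>norm \<epsilon> < 1\<close> unfolding affine_linear_invariant_def by blast
  then obtain k where k: "k \<in> F" "\<And>z. z \<in> unit_disk \<Longrightarrow> k z = affine_change \<epsilon> f g z"
    by blast
  note D = harmonic_partsD[OF F hg]
  have eq: "f z = h z + cnj (g z)" if "z \<in> unit_disk" for z
    using f(2) that by (simp add: harmonic_repr_def)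
  \<comment> \<open>Since h'(0) = 1, g'(0) is the dilatation at 0; its modulus being below 1 keeps
    both denominators away from 0.\<close>
  have "norm (deriv g 0) < 1" using D(5) bspec[OF D(6)[unfolded sense_preserving_def], of 0] by simp
  then have "norm (cnj \<epsilon> * deriv g 0) < 1"
    using \<open>norm \<epsilon> < 1\<close> by (metis complex_mod_cnj norm_mult_less mult_1)
  then have nz: "1 - cnj \<epsilon> * deriv g 0 \<noteq> 0" by auto
  moreover have "1 - \<epsilon> * cnj (deriv g 0) = cnj (1 - cnj \<epsilon> * deriv g 0)" by simp
  ultimately have nz': "1 - \<epsilon> * cnj (deriv g 0) \<noteq> 0" by (metis complex_cnj_zero_iff)
  show ?thesis
    unfolding harmonic_parts_def mem_Collect_eq case_prod_conv
  proof (rule bexI[OF _ k(1)])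
    show "harmonic_repr k (\<lambda>z. (h z - cnj \<epsilon> * g z) / (1 - cnj \<epsilon> * deriv g 0))
      (\<lambda>z. (g z - \<epsilon> * h z) / cnj (1 - cnj \<epsilon> * deriv g 0))"
      using D nz nz' unfolding harmonic_repr_def
      by (auto intro!: holomorphic_intros simp: k(2) eq affine_change_def)
        (simp add: add_divide_distrib diff_divide_distrib algebra_simps)
  qed
qed

section \<open>Koebe transforms along self-maps of the disk\<close>

definition koebe_analytic :: "(complex \<Rightarrow> complex) \<Rightarrow> (complex \<Rightarrow> complex) \<Rightarrow> complex \<Rightarrow> complex" where
  "koebe_analytic \<psi> h z = (h (\<psi> z) - h (\<psi> 0)) / deriv (h \<circ> \<psi>) 0"

text \<open>The normalizing constant is conjugated because \<open>g\<close> enters the harmonic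
  function through \<open>cnj (g z)\<close>.\<close>

definition koebe_coanalytic ::
  "(complex \<Rightarrow> complex) \<Rightarrow> (complex \<Rightarrow> complex) \<Rightarrow> (complex \<Rightarrow> complex) \<Rightarrow> complex \<Rightarrow> complex" where
  "koebe_coanalytic \<psi> h g z = (g (\<psi> z) - g (\<psi> 0)) / cnj (deriv (h \<circ> \<psi>) 0)"

text \<open>Formulated for arbitrary self-maps rather than for \<open>disk_shift\<close> alone, so
  that compositions of shifts, and rotations among them, count as single transforms.\<close>

definition koebe_admissible :: "(complex \<Rightarrow> complex) set \<Rightarrow> (complex \<Rightarrow> complex) \<Rightarrow> bool" where
  "koebe_admissible F \<psi> \<longleftrightarrow> \<psi> holomorphic_on unit_disk \<and> \<psi> ` unit_disk \<subseteq> unit_disk \<and>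
     (\<forall>(h, g) \<in> harmonic_parts F. (koebe_analytic \<psi> h, koebe_coanalytic \<psi> h g) \<in> harmonic_parts F)"

definition disk_shift :: "complex \<Rightarrow> complex \<Rightarrow> complex" where
  "disk_shift \<zeta> z = (z + \<zeta>) / (1 + cnj \<zeta> * z)"

lemma disk_shift_eq_Moebius: "disk_shift \<zeta> = Moebius_function 0 (- \<zeta>)"
  by (simp add: disk_shift_def Moebius_function_def fun_eq_iff)

lemma disk_shift_in_disk: "norm \<zeta> < 1 \<Longrightarrow> z \<in> unit_disk \<Longrightarrow> disk_shift \<zeta> z \<in> unit_disk"
  by (simp add: disk_shift_eq_Moebius Moebius_function_norm_lt_1)

lemma disk_shift_holomorphic: "norm \<zeta> < 1 \<Longrightarrow> disk_shift \<zeta> holomorphic_on unit_disk"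
  by (simp add: disk_shift_eq_Moebius Moebius_function_holomorphic)

lemma one_plus_mult_nonzero:
  fixes x y :: complex
  assumes "norm x < 1" "norm y < 1"
  shows "1 + x * y \<noteq> 0"
proof
  assume "1 + x * y = 0"
  then have "norm (x * y) = 1" by (metis add_eq_0_iff norm_minus_cancel norm_one)
  then show False using norm_mult_less[OF assms] by simp
qed

lemma disk_shift_derivative:
  assumes "norm \<zeta> < 1" "z \<in> unit_disk"
  shows "(disk_shift \<zeta> has_field_derivative (1 - \<zeta> * cnj \<zeta>) / (1 + cnj \<zeta> * z)\<^sup>2) (at z)"
  unfolding disk_shift_def using one_plus_mult_nonzero[of "cnj \<zeta>" z] assms
  by (auto intro!: derivative_eq_intros simp: power2_eq_square) (simp add: algebra_simps)

lemma deriv_compose_disk_shift: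
  assumes "h holomorphic_on unit_disk" "norm \<zeta> < 1"
  shows "deriv (h \<circ> disk_shift \<zeta>) 0 = deriv h \<zeta> * (1 - \<zeta> * cnj \<zeta>)"
proof -
  have "disk_shift \<zeta> 0 = \<zeta>" by (simp add: disk_shift_def)
  then have "(h has_field_derivative deriv h \<zeta>) (at (disk_shift \<zeta> 0))"
    using holomorphic_derivI[OF assms(1), of \<zeta>] assms(2) by simp
  from DERIV_chain[OF this disk_shift_derivative[of \<zeta> 0]] show ?thesis
    using assms(2) by (auto intro!: DERIV_imp_deriv)
qed

text \<open>By the chain rule the normalizing constant is
  \<open>(1 - (norm \<zeta>)\<^sup>2) * deriv h \<zeta>\<close>, so this is the Koebe transform
  under which \<open>F\<close> is closed.\<close>

lemma koebe_admissible_disk_shift: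
  assumes F: "affine_linear_invariant F" and "norm \<zeta> < 1"
  shows "koebe_admissible F (disk_shift \<zeta>)"
proof -
  have "(koebe_analytic (disk_shift \<zeta>) h, koebe_coanalytic (disk_shift \<zeta>) h g) \<in> harmonic_parts F"
    if hg: "(h, g) \<in> harmonic_parts F" for h g
  proof -
    obtain f where f: "f \<in> F" "harmonic_repr f h g"
      using hg by (auto simp: harmonic_parts_def)
    then have "\<exists>k\<in>F. \<forall>z\<in>unit_disk. k z = koebe_transform \<zeta> f h z"
      using F \<open>norm \<zeta> < 1\<close> unfolding affine_linear_invariant_def by blast
    then obtain k where k: "k \<in> F" "\<And>z. z \<in> unit_disk \<Longrightarrow> k z = koebe_transform \<zeta> f h z"
      by blast
    note D = harmonic_partsD[OF F hg]
    have z0: "disk_shift \<zeta> 0 = \<zeta>" by (simp add: disk_shift_def)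
    have d: "deriv (h \<circ> disk_shift \<zeta>) 0 = complex_of_real (1 - (norm \<zeta>)\<^sup>2) * deriv h \<zeta>"
      unfolding deriv_compose_disk_shift[OF D(1) \<open>norm \<zeta> < 1\<close>] of_real_diff complex_norm_square[of \<zeta>] by simp
    define c where "c = complex_of_real (1 - (norm \<zeta>)\<^sup>2) * deriv h \<zeta>"
    have "\<zeta> \<in> unit_disk" using \<open>norm \<zeta> < 1\<close> by simp
    have "deriv h \<zeta> \<noteq> 0" using D(6) \<open>\<zeta> \<in> unit_disk\<close> by (auto simp: sense_preserving_def)
    moreover have "(norm \<zeta>)\<^sup>2 < 1" using \<open>norm \<zeta> < 1\<close> by (simp add: abs_square_less_1)
    then have "complex_of_real (1 - (norm \<zeta>)\<^sup>2) \<noteq> 0" by (metis of_real_eq_0_iff diff_gt_0_iff_gt less_irrefl)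
    ultimately have "c \<noteq> 0" by (simp add: c_def del: of_real_diff)
    have hs: "(\<lambda>z. h (disk_shift \<zeta> z)) holomorphic_on unit_disk"
         "(\<lambda>z. g (disk_shift \<zeta> z)) holomorphic_on unit_disk"
      using holomorphic_on_compose_gen[OF disk_shift_holomorphic[OF \<open>norm \<zeta> < 1\<close>], of _ unit_disk]
        disk_shift_in_disk[OF \<open>norm \<zeta> < 1\<close>] D(1,2) by (force simp: o_def)+
    have fz: "f z = h z + cnj (g z)" if "z \<in> unit_disk" for z
      using f(2) that by (simp add: harmonic_repr_def)
    have kz: "k z = (f (disk_shift \<zeta> z) - f \<zeta>) / c" if "z \<in> unit_disk" for z
      using k(2)[OF that] by (simp add: koebe_transform_def disk_shift_def c_def)
    have "harmonic_repr k (koebe_analytic (disk_shift \<zeta>) h) (koebe_coanalytic (disk_shift \<zeta>) h g)"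
      unfolding harmonic_repr_def koebe_analytic_def koebe_coanalytic_def d c_def[symmetric]
      using \<open>c \<noteq> 0\<close>
      by (auto intro!: holomorphic_intros hs simp: kz fz disk_shift_in_disk[OF \<open>norm \<zeta> < 1\<close>]
           fz[OF \<open>\<zeta> \<in> unit_disk\<close>] z0 simp del: mem_ball mem_ball_0)
        (simp add: field_simps)
    then show ?thesis using k(1) by (auto simp: harmonic_parts_def)
  qed
  then show ?thesis
    using disk_shift_holomorphic disk_shift_in_disk assms unfolding koebe_admissible_def by blast
qed

text \<open>Transforming along \<open>\<psi>\<close> and then along \<open>\<phi>\<close> is
  transforming along \<open>\<psi> \<circ> \<phi>\<close>: the first normalizing constant cancels.
  It is nonzero since neither \<open>deriv h\<close> on the disk nor \<open>deriv \<psi> 0\<close>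
  vanishes.\<close>

lemma koebe_admissible_compose:
  assumes F: "affine_linear_invariant F" and "koebe_admissible F \<psi>" "koebe_admissible F \<phi>" "deriv \<psi> 0 \<noteq> 0"
  shows "koebe_admissible F (\<psi> \<circ> \<phi>)"
proof -
  have psi: "\<psi> holomorphic_on unit_disk" "\<And>z. z \<in> unit_disk \<Longrightarrow> \<psi> z \<in> unit_disk"
    and chi: "\<phi> holomorphic_on unit_disk" "\<And>z. z \<in> unit_disk \<Longrightarrow> \<phi> z \<in> unit_disk"
    using assms unfolding koebe_admissible_def by blast+
  have "(koebe_analytic (\<psi> \<circ> \<phi>) h, koebe_coanalytic (\<psi> \<circ> \<phi>) h g) \<in> harmonic_parts F"
    if hg: "(h, g) \<in> harmonic_parts F" for h g
  proof -
    note D = harmonic_partsD[OF F hg]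
    define d where "d = deriv (h \<circ> \<psi>) 0"
    have "0 \<in> unit_disk" by simp
    have p0: "\<psi> 0 \<in> unit_disk" using psi by simp
    have "deriv (h \<circ> \<psi>) 0 = deriv h (\<psi> 0) * deriv \<psi> 0"
      using D(1) psi(1) p0
      by (intro deriv_chain) (auto simp: holomorphic_on_imp_differentiable_at[OF _ open_ball])
    then have "d \<noteq> 0" using assms(4) D(6) p0 by (auto simp: d_def sense_preserving_def)
    have hpc: "(h \<circ> (\<psi> \<circ> \<phi>)) holomorphic_on unit_disk"
      using psi chi D(1) by (intro holomorphic_on_compose_gen[of _ _ _ unit_disk]) auto
    have "deriv (koebe_analytic \<psi> h \<circ> \<phi>) 0 = deriv (h \<circ> (\<psi> \<circ> \<phi>)) 0 / d"
    proof (rule DERIV_imp_deriv)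
      have "(h \<circ> (\<psi> \<circ> \<phi>) has_field_derivative deriv (h \<circ> (\<psi> \<circ> \<phi>)) 0) (at 0)"
        using holomorphic_derivI[OF hpc open_ball \<open>0 \<in> unit_disk\<close>] .
      then have "((\<lambda>z. ((h \<circ> (\<psi> \<circ> \<phi>)) z - h (\<psi> 0)) / d) has_field_derivative
          (deriv (h \<circ> (\<psi> \<circ> \<phi>)) 0 - 0) / d) (at 0)"
        by (intro DERIV_cdivide DERIV_diff DERIV_const)
      moreover have "koebe_analytic \<psi> h \<circ> \<phi> = (\<lambda>z. ((h \<circ> (\<psi> \<circ> \<phi>)) z - h (\<psi> 0)) / d)"
        by (simp add: fun_eq_iff koebe_analytic_def d_def)
      ultimately show "(koebe_analytic \<psi> h \<circ> \<phi> has_field_derivative deriv (h \<circ> (\<psi> \<circ> \<phi>)) 0 / d) (at 0)"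
        by simp
    qed
    then have "koebe_analytic \<phi> (koebe_analytic \<psi> h) = koebe_analytic (\<psi> \<circ> \<phi>) h"
      "koebe_coanalytic \<phi> (koebe_analytic \<psi> h) (koebe_coanalytic \<psi> h g) = koebe_coanalytic (\<psi> \<circ> \<phi>) h g"
      using \<open>d \<noteq> 0\<close>
      by (auto simp: fun_eq_iff koebe_analytic_def[of \<phi>] koebe_coanalytic_def[of \<phi>])
        (auto simp: koebe_analytic_def koebe_coanalytic_def d_def[symmetric] diff_divide_distrib[symmetric])
    moreover have "(koebe_analytic \<psi> h, koebe_coanalytic \<psi> h g) \<in> harmonic_parts F"
      using assms(2) hg unfolding koebe_admissible_def by blast
    then have "(koebe_analytic \<phi> (koebe_analytic \<psi> h),
        koebe_coanalytic \<phi> (koebe_analytic \<psi> h) (koebe_coanalytic \<psi> h g)) \<in> harmonic_parts F"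
      using assms(3) unfolding koebe_admissible_def by blast
    ultimately show ?thesis by simp
  qed
  moreover have "\<psi> \<circ> \<phi> holomorphic_on unit_disk" "(\<psi> \<circ> \<phi>) ` unit_disk \<subseteq> unit_disk"
    using psi chi holomorphic_on_compose_gen[of \<phi> unit_disk \<psi> unit_disk] by force+
  ultimately show ?thesis unfolding koebe_admissible_def by blast
qed

text \<open>Needed because a composition of shifts is identified with a rotation on the disk
  only.\<close>

lemma koebe_admissible_cong:
  assumes "koebe_admissible F \<psi>" "\<And>z. z \<in> unit_disk \<Longrightarrow> \<psi> z = \<phi> z"
  shows "koebe_admissible F \<phi>"
proof -
  have "deriv (h \<circ> \<psi>) 0 = deriv (h \<circ> \<phi>) 0" for h
  proof (rule deriv_cong_ev)
    show "eventually (\<lambda>z. (h \<circ> \<psi>) z = (h \<circ> \<phi>) z) (nhds 0)"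
      using assms(2) by (intro eventually_nhds_in_open[of unit_disk, THEN eventually_mono]) auto
  qed simp
  then have "koebe_analytic \<psi> h z = koebe_analytic \<phi> h z"
    "koebe_coanalytic \<psi> h g z = koebe_coanalytic \<phi> h g z" if "z \<in> unit_disk" for h g z
    using assms(2) that by (auto simp: koebe_analytic_def koebe_coanalytic_def)
  note eq = this
  have "(koebe_analytic \<phi> h, koebe_coanalytic \<phi> h g) \<in> harmonic_parts F"
    if "(h, g) \<in> harmonic_parts F" for h g
  proof (rule harmonic_parts_cong)
    show "(koebe_analytic \<psi> h, koebe_coanalytic \<psi> h g) \<in> harmonic_parts F"
      using assms(1) that unfolding koebe_admissible_def by blast
  qed (use eq in auto)
  moreover have "\<phi> holomorphic_on unit_disk" 
    using assms holomorphic_cong[of unit_disk unit_disk \<psi> \<phi>] by (simp add: koebe_admissible_def)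
  moreover have "\<phi> ` unit_disk \<subseteq> unit_disk"
    using assms by (force simp: koebe_admissible_def simp del: mem_ball mem_ball_0)
  ultimately show ?thesis by (auto simp: koebe_admissible_def)
qed

subsection \<open>Rotations\<close>

text \<open>The shift by \<open>cnj q\<close> followed by the shift by \<open>q\<close> sends x to
  (a x + t) / (cnj a + t x) with a = 1 + q^2 and t = q + cnj q. It rotates by a / cnj a and moves
  the origin. So \<open>q\<close> is chosen with a / cnj a = u, and the first shift, by the zero
  \<open>d\<close> of this map, restores the origin.\<close>

lemma disk_shift_triple_rotation:
  assumes "norm u = 1" "u \<noteq> - 1"
  obtains q d where "norm q < 1" "norm d < 1"
    "\<And>z. z \<in> unit_disk \<Longrightarrow> (disk_shift q \<circ> (disk_shift (cnj q) \<circ> disk_shift d)) z = u * z"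
proof -
  define v where "v = csqrt u"
  have v2: "v\<^sup>2 = u" by (simp add: v_def)
  then have "(norm v)\<^sup>2 = 1" using assms(1) by (metis norm_power)
  then have "norm v = 1" by (metis norm_ge_zero power2_eq_1_iff abs_of_nonneg abs_1 real_sqrt_abs real_sqrt_one)
  then have vc: "v * cnj v = 1" by (simp add: complex_norm_square[symmetric])
  have "Re v \<noteq> 0"
  proof
    assume "Re v = 0"
    then have "(Im v)\<^sup>2 = 1" using \<open>norm v = 1\<close> by (metis cmod_power2 add_0 zero_power2 one_power2)
    then have "v\<^sup>2 = - 1" using \<open>Re v = 0\<close> by (simp add: complex_eq_iff power2_eq_square)
    with v2 assms(2) show False by simp
  qed
  moreover have "Re v \<ge> 0" by (simp add: v_def Re_csqrt del: csqrt.sel)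
  ultimately have "Re v > 0" by simp
  \<comment> \<open>A positive multiple of a square root \<open>v\<close> of \<open>u\<close>
    satisfies a / cnj a = v^2 = u. The factor \<open>Re v\<close>, positive because \<open>u\<close>
    is not -1, gives |a - 1|^2 = 1 - (Re v)^2 < 1, so that q^2 = a - 1 has a solution in the
    disk.\<close>
  define a where "a = complex_of_real (Re v) * v"
  define p where "p = a - 1"
  define q where "q = csqrt p"
  have q2: "q * q = a - 1" by (metis q_def p_def power2_csqrt power2_eq_square)
  have q2c: "cnj q * cnj q = cnj a - 1"
    by (metis q2 complex_cnj_mult complex_cnj_diff complex_cnj_one)
  have "a \<noteq> 0" using \<open>Re v > 0\<close> \<open>norm v = 1\<close> by (auto simp: a_def)
  then have ca: "cnj a \<noteq> 0" by simp
  have ua: "a = u * cnj a"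
    using vc by (simp add: a_def v2[symmetric] power2_eq_square)
  have "(norm p)\<^sup>2 = (Re v * Re v - 1)\<^sup>2 + (Re v * Im v)\<^sup>2"
    by (simp add: p_def a_def cmod_power2)
  also have "\<dots> = 1 - (Re v)\<^sup>2 * (2 - ((Re v)\<^sup>2 + (Im v)\<^sup>2))"
    by (simp add: power2_eq_square algebra_simps)
  also have "(Re v)\<^sup>2 + (Im v)\<^sup>2 = 1" using \<open>norm v = 1\<close> by (metis cmod_power2 one_power2)
  finally have "(norm p)\<^sup>2 < 1" using \<open>Re v > 0\<close> by simp
  then have "norm p < 1" by (metis norm_ge_zero one_power2 power2_less_imp_less zero_le_one)
  then have q: "norm q < 1"
    by (simp add: q_def norm_csqrt)
  define t where "t = q + cnj q"
  define d where "d = - t / a"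
  \<comment> \<open>Seen as the image of \<open>- q\<close> under a shift, \<open>d\<close> lies in
    the disk.\<close>
  have "d = disk_shift (- cnj q) (- q)"
    by (simp add: disk_shift_def d_def t_def q2)
  then have d: "norm d < 1" using disk_shift_in_disk[of "- cnj q" "- q"] q by simp
  have ad: "a * d = - t" using \<open>a \<noteq> 0\<close> by (simp add: d_def)
  have "cnj t = t" by (simp add: t_def)
  then have "cnj d = - t / cnj a" by (simp add: d_def)
  then have cd: "cnj a * cnj d = - t" using ca by simp
  have "cnj a * cnj d = cnj a * (u * d)" using cd ad ua by (metis mult.assoc mult.commute)
  then have du: "cnj d = u * d" using ca by simp
  show ?thesis
  proof (rule that[OF q d])
    fix z assume z: "z \<in> unit_disk"
    define x where "x = disk_shift d z"
    define y where "y = disk_shift (cnj q) x"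
    define w where "w = disk_shift q y"
    have xd: "norm x < 1" using disk_shift_in_disk[OF d z] by (simp add: x_def)
    have yd: "norm y < 1" using disk_shift_in_disk[of "cnj q" x] xd q by (simp add: y_def)
    have n: "1 + cnj d * z \<noteq> 0" "1 + q * x \<noteq> 0" "1 + cnj q * y \<noteq> 0"
      using one_plus_mult_nonzero d z q xd yd by auto
    have x: "x * (1 + cnj d * z) = z + d" using n(1) by (simp add: x_def disk_shift_def)
    have y: "y * (1 + q * x) = x + cnj q" using n(2) by (simp add: y_def disk_shift_def)
    have w: "w * (1 + cnj q * y) = y + q" using n(3) by (simp add: w_def disk_shift_def)
    have den: "(1 + cnj q * y) * (1 + q * x) = cnj a + t * x"
    proof -
      have "(1 + cnj q * y) * (1 + q * x) = 1 + q * x + cnj q * (y * (1 + q * x))"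
        by (simp add: algebra_simps)
      also have "\<dots> = 1 + q * x + cnj q * (x + cnj q)" by (simp only: y)
      finally show ?thesis by (simp add: ring_distribs q2c t_def)
    qed
    have num: "w * (cnj a + t * x) = a * x + t"
    proof -
      have "w * ((1 + cnj q * y) * (1 + q * x)) = (y + q) * (1 + q * x)"
        by (metis w mult.assoc)
      also have "\<dots> = y * (1 + q * x) + q + (q * q) * x" by (simp add: algebra_simps)
      also have "\<dots> = (x + cnj q) + q + (a - 1) * x" by (simp only: y q2)
      finally show ?thesis unfolding den by (simp add: t_def algebra_simps)
    qed
    \<comment> \<open>With x = (z + d) / (1 + cnj d z), the relation a d = -t removes the constant
      term of the numerator and its conjugate removes the linear term of the denominator. What
      remains is z times the quotient of a + t cnj d by its conjugate, which is
      \<open>u\<close>.\<close>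
    have "(a * x + t) * (1 + cnj d * z) = (u * z * (cnj a + t * x)) * (1 + cnj d * z)"
    proof -
      have "(a * x + t) * (1 + cnj d * z) = a * (x * (1 + cnj d * z)) + t * (1 + cnj d * z)"
        by (simp add: algebra_simps)
      also have "\<dots> = a * (z + d) + t * (1 + cnj d * z)" by (simp only: x)
      also have "\<dots> = (a + t * cnj d) * z" by (simp add: ring_distribs ad)
      finally have L: "(a * x + t) * (1 + cnj d * z) = (a + t * cnj d) * z" .
      have "(u * z * (cnj a + t * x)) * (1 + cnj d * z) =
          u * z * (cnj a + (cnj a * cnj d) * z + t * (x * (1 + cnj d * z)))"
        by (simp add: algebra_simps)
      also have "\<dots> = u * z * (cnj a + - t * z + t * (z + d))" by (simp only: x cd)
      also have "\<dots> = u * z * (cnj a + t * d)" by (simp add: ring_distribs)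
      also have "\<dots> = (a + t * cnj d) * z" by (subst (2) ua) (simp add: du algebra_simps)
      finally show ?thesis by (simp only: L)
    qed
    then have "w * (cnj a + t * x) = u * z * (cnj a + t * x)" using n(1) num by simp
    moreover have "cnj a + t * x \<noteq> 0" using n den by (metis mult_eq_0_iff)
    ultimately show "(disk_shift q \<circ> (disk_shift (cnj q) \<circ> disk_shift d)) z = u * z"
      by (simp add: w_def y_def x_def)
  qed
qed

lemma deriv_disk_shift_0: "norm \<zeta> < 1 \<Longrightarrow> deriv (disk_shift \<zeta>) 0 \<noteq> 0"
proof -
  assume z: "norm \<zeta> < 1"
  have "deriv (disk_shift \<zeta>) 0 = 1 + \<zeta> * (- cnj \<zeta>)"
    using disk_shift_derivative[OF z, of 0] by (auto intro: DERIV_imp_deriv)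
  then show ?thesis using one_plus_mult_nonzero[of \<zeta> "- cnj \<zeta>"] z by simp
qed

text \<open>The excluded value -1 is reached by rotating twice by a square root of \<open>u\<close>:
  the principal root has nonnegative real part and so is never -1.\<close>

lemma koebe_admissible_rotation:
  assumes F: "affine_linear_invariant F" and "norm u = 1"
  shows "koebe_admissible F ((*) u)"
proof -
  have *: "koebe_admissible F ((*) u)" if u: "norm u = 1" "u \<noteq> - 1" for u
  proof -
    obtain q d where q: "norm q < 1" "norm d < 1"
      and eq: "\<And>z. z \<in> unit_disk \<Longrightarrow> (disk_shift q \<circ> (disk_shift (cnj q) \<circ> disk_shift d)) z = u * z"
      using disk_shift_triple_rotation[OF u] by blast
    have "koebe_admissible F (disk_shift q \<circ> (disk_shift (cnj q) \<circ> disk_shift d))"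
      using q by (intro koebe_admissible_compose F koebe_admissible_disk_shift deriv_disk_shift_0) auto
    then show ?thesis by (rule koebe_admissible_cong) (rule eq)
  qed
  define v where "v = csqrt u"
  have v2: "v\<^sup>2 = u" by (simp add: v_def)
  then have "(norm v)\<^sup>2 = 1" using assms(2) by (metis norm_power)
  then have v: "norm v = 1" by (metis norm_ge_zero power2_eq_1_iff abs_of_nonneg abs_1 real_sqrt_abs real_sqrt_one)
  have "v \<noteq> - 1"
    using Re_csqrt[of u] by (auto simp: v_def simp del: csqrt.sel)
  with v have "koebe_admissible F ((*) v)" by (rule *)
  moreover have "deriv ((*) v) 0 \<noteq> 0" using v by auto
  ultimately have "koebe_admissible F ((*) v \<circ> (*) v)" by (intro koebe_admissible_compose F)
  moreover have "(*) v \<circ> (*) v = (*) u" by (auto simp: fun_eq_iff v2[symmetric] power2_eq_square)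
  ultimately show ?thesis by simp
qed

text \<open>The subtracted zeros keep the shape to which \<open>taylor_coeff_affine\<close>
  applies.\<close>

lemma harmonic_parts_rotate:
  assumes F: "affine_linear_invariant F" and hg: "(h, g) \<in> harmonic_parts F" and "norm u = 1"
  shows "(\<lambda>z. (h (u * z) - 0) / u, \<lambda>z. (g (u * z) - 0) / cnj u) \<in> harmonic_parts F"
proof -
  note D = harmonic_partsD[OF F hg]
  have "(h has_field_derivative 1) (at (u * 0))"
    using holomorphic_derivI[OF D(1) open_ball, of 0] D(5) by simp
  then have "(h \<circ> (*) u has_field_derivative 1 * u) (at 0)"
    by (rule DERIV_chain) (auto intro!: derivative_eq_intros)
  then have "deriv (h \<circ> (*) u) 0 = u"
    by (auto intro!: DERIV_imp_deriv)
  then have "koebe_analytic ((*) u) h = (\<lambda>z. (h (u * z) - 0) / u)"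
    "koebe_coanalytic ((*) u) h g = (\<lambda>z. (g (u * z) - 0) / cnj u)"
    using D(3,4) by (auto simp: koebe_analytic_def koebe_coanalytic_def fun_eq_iff)
  moreover have "(koebe_analytic ((*) u) h, koebe_coanalytic ((*) u) h g) \<in> harmonic_parts F"
    using koebe_admissible_rotation[OF F \<open>norm u = 1\<close>] hg unfolding koebe_admissible_def by blast
  ultimately show ?thesis by simp
qed

section \<open>The subfamily with g'(0) = 0 and its second coefficients\<close>

lemma harmonic_parts_zero_subfamily_iff:
  "(h, g) \<in> harmonic_parts (zero_subfamily F) \<longleftrightarrow> (h, g) \<in> harmonic_parts F \<and> deriv g 0 = 0"
proof
  assume "(h, g) \<in> harmonic_parts (zero_subfamily F)"
  then obtain f h' g' where f: "f \<in> F" "harmonic_repr f h g" "harmonic_repr f h' g'" "deriv g' 0 = 0"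
    by (auto simp: harmonic_parts_def zero_subfamily_def)
  have "eventually (\<lambda>z. g z = g' z) (nhds 0)"
    using harmonic_repr_unique(2)[OF f(2,3)]
    by (intro eventually_nhds_in_open[of unit_disk, THEN eventually_mono]) auto
  then have "deriv g 0 = deriv g' 0" by (intro deriv_cong_ev) auto
  then show "(h, g) \<in> harmonic_parts F \<and> deriv g 0 = 0"
    using f by (auto simp: harmonic_parts_def)
qed (auto simp: harmonic_parts_def zero_subfamily_def)

text \<open>The affine change with parameter b = g'(0) cancels the linear term of the coanalytic
  part, since h'(0) = 1. Its denominator 1 - |b|^2 is real, so no conjugate remains.\<close>

lemma harmonic_parts_normalize:
  assumes F: "affine_linear_invariant F" and hg: "(h, g) \<in> harmonic_parts F"
  defines "b \<equiv> deriv g 0"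
  shows "norm b < 1"
    "(\<lambda>z. (h z - cnj b * g z) / (1 - cnj b * b), \<lambda>z. (g z - b * h z) / (1 - cnj b * b))
       \<in> harmonic_parts (zero_subfamily F)"
proof -
  note D = harmonic_partsD[OF F hg]
  show b: "norm b < 1"
    using D(5) bspec[OF D(6)[unfolded sense_preserving_def], of 0] by (simp add: b_def)
  have "((\<lambda>z. (g z - b * h z) / (1 - cnj b * b)) has_field_derivative
      (deriv g 0 - b * deriv h 0) / (1 - cnj b * b)) (at 0)"
    using holomorphic_derivI[OF D(1) open_ball, of 0] holomorphic_derivI[OF D(2) open_ball, of 0]
    by (intro DERIV_cdivide DERIV_diff DERIV_cmult) auto
  then have "deriv (\<lambda>z. (g z - b * h z) / (1 - cnj b * b)) 0 = 0"
    using D(5) by (auto simp: b_def dest: DERIV_imp_deriv)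
  moreover have "cnj (1 - cnj b * b) = 1 - cnj b * b" by simp
  ultimately show "(\<lambda>z. (h z - cnj b * g z) / (1 - cnj b * b), \<lambda>z. (g z - b * h z) / (1 - cnj b * b))
       \<in> harmonic_parts (zero_subfamily F)"
    using harmonic_parts_affine_change[OF F hg b]
    unfolding harmonic_parts_zero_subfamily_iff b_def[symmetric] by metis
qed

lemma unimodular_power_mult_norm:
  assumes "k > 0"
  obtains u where "norm u = 1" "u ^ k * c = complex_of_real (norm c)"
proof (rule that)
  show "norm (cis (- (Arg c / real k))) = 1" by simp
  have "cis (- (Arg c / real k)) ^ k = cis (- Arg c)"
  proof -
    have "real k * (- (Arg c / real k)) = - Arg c" using assms by simp
    then show ?thesis by (metis Complex.DeMoivre)
  qed
  moreover have "c = of_real (norm c) * cis (Arg c)" by (metis rcis_cmod_Arg rcis_def)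
  moreover have "cis (- Arg c) * (of_real (norm c) * cis (Arg c)) = of_real (norm c)"
    by (metis cis_mult add.left_inverse cis_zero mult.left_commute mult_1_right)
  ultimately show "cis (- (Arg c / real k)) ^ k * c = complex_of_real (norm c)"
    by metis
qed

lemma zero_subfamily_rotate:
  assumes F: "affine_linear_invariant F" and hg: "(h, g) \<in> harmonic_parts (zero_subfamily F)" and u: "norm u = 1"
  shows "(\<lambda>z. (h (u * z) - 0) / u, \<lambda>z. (g (u * z) - 0) / cnj u) \<in> harmonic_parts (zero_subfamily F)"
    "taylor_coeff (\<lambda>z. (h (u * z) - 0) / u) 2 = u * taylor_coeff h 2"
    "taylor_coeff (\<lambda>z. (g (u * z) - 0) / cnj u) 2 = u ^ 3 * taylor_coeff g 2"
proof -
  from hg have hg': "(h, g) \<in> harmonic_parts F" "deriv g 0 = 0"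
    by (auto simp: harmonic_parts_zero_subfamily_iff)
  note D = harmonic_partsD[OF F hg'(1)]
  have *: "taylor_coeff (\<lambda>z. (f (u * z) - 0) / c) n = u ^ n * taylor_coeff f n / c"
    if "f holomorphic_on unit_disk" "n > 0" for f c n
  proof -
    have "f \<circ> (*) u holomorphic_on unit_disk"
      using that u by (intro holomorphic_on_compose_gen[of _ _ _ unit_disk] holomorphic_intros)
        (auto simp: norm_mult)
    then have "(\<lambda>z. f (u * z)) holomorphic_on unit_disk" by (simp add: o_def)
    from taylor_coeff_affine[OF this _ \<open>n > 0\<close>, of 0 c] taylor_coeff_rotate[OF that(1)]
    show ?thesis by simp
  qed
  show "taylor_coeff (\<lambda>z. (h (u * z) - 0) / u) 2 = u * taylor_coeff h 2"
    using *[OF D(1), of 2 u] u by (auto simp: power2_eq_square)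
  \<comment> \<open>The exponent 3 arises as 2 + 1: u^2 from the composition and one more factor
    from 1 / cnj u = u.\<close>
  have uc: "u * cnj u = 1" using u by (simp add: complex_norm_square[symmetric])
  then have "u\<^sup>2 / cnj u = u ^ 3"
    by (metis nonzero_eq_divide_eq mult_zero_right zero_neq_one power2_eq_square power3_eq_cube mult.assoc mult_1_right)
  then show "taylor_coeff (\<lambda>z. (g (u * z) - 0) / cnj u) 2 = u ^ 3 * taylor_coeff g 2"
    using *[OF D(2), of 2 "cnj u"] by (simp add: times_divide_eq_left[symmetric] del: times_divide_eq_left)
  show "(\<lambda>z. (h (u * z) - 0) / u, \<lambda>z. (g (u * z) - 0) / cnj u) \<in> harmonic_parts (zero_subfamily F)"
    using harmonic_parts_rotate[OF F hg'(1) u] *[OF D(2), of 1 "cnj u"] hg'(2)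
    by (simp add: harmonic_parts_zero_subfamily_iff taylor_coeff_1)
qed

text \<open>Rotations multiply the two coefficients by u and u^3, so each can be made nonnegative
  within the subfamily; bounds for real parts are then bounds for moduli.\<close>

lemma zero_subfamily_second_coeff_bounds:
  assumes F: "affine_linear_invariant F" and hg: "(h, g) \<in> harmonic_parts (zero_subfamily F)"
    and A: "\<And>h g. (h, g) \<in> harmonic_parts (zero_subfamily F) \<Longrightarrow> Re (taylor_coeff h 2) \<le> A"
    and B: "\<And>h g. (h, g) \<in> harmonic_parts (zero_subfamily F) \<Longrightarrow> Re (taylor_coeff g 2) \<le> B"
  shows "norm (taylor_coeff h 2) \<le> A" "norm (taylor_coeff g 2) \<le> B"
proof -
  obtain u where u: "norm u = 1" "u ^ 1 * taylor_coeff h 2 = of_real (norm (taylor_coeff h 2))"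
    by (rule unimodular_power_mult_norm[of 1]) auto
  show "norm (taylor_coeff h 2) \<le> A"
    using A[OF zero_subfamily_rotate(1)[OF F hg u(1)]] zero_subfamily_rotate(2)[OF F hg u(1)] u(2) by simp
  obtain v where v: "norm v = 1" "v ^ 3 * taylor_coeff g 2 = of_real (norm (taylor_coeff g 2))"
    by (rule unimodular_power_mult_norm[of 3]) auto
  show "norm (taylor_coeff g 2) \<le> B"
    using B[OF zero_subfamily_rotate(1)[OF F hg v(1)]] zero_subfamily_rotate(3)[OF F hg v(1)] v(2) by simp
qed

subsection \<open>The variational relation\<close>

definition real_taylor :: "(complex \<Rightarrow> complex) \<Rightarrow> bool" where
  "real_taylor f \<longleftrightarrow> (\<forall>n. taylor_coeff f n \<in> \<real>)"

text \<open>For real \<open>t\<close> the inner map is \<open>disk_shift t\<close>, but written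
  without conjugation it is holomorphic in \<open>t\<close>. Its \<open>t\<close>-derivative at 0 is
  1 - z^2.\<close>

lemma taylor_coeff_disk_shift_deriv:
  assumes h: "h holomorphic_on unit_disk"
  shows "((\<lambda>t. taylor_coeff (\<lambda>z. h ((z + t) / (1 + t * z))) n) has_field_derivative
      taylor_coeff (\<lambda>z. (1 - z\<^sup>2) * deriv h z) n) (at 0)"
proof -
  define m where "m = (\<lambda>t z :: complex. (z + t) / (1 + t * z))"
  define D where "D = (\<lambda>t z :: complex. deriv h (m t z) * ((1 - z\<^sup>2) / (1 + t * z)\<^sup>2))"
  \<comment> \<open>For nonreal \<open>t\<close> the map need not preserve the disk, whence the
    small radii: |z + t| < 2/3 while |1 + t z| is at least 8/9.\<close>
  have nz: "1 + t * z \<noteq> 0" and m: "m t z \<in> unit_disk" if "t \<in> ball 0 (1/3)" "z \<in> ball 0 (1/3)" for t z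
  proof -
    show nz: "1 + t * z \<noteq> 0" using that by (intro one_plus_mult_nonzero) auto
    have "norm (t * z) \<le> 1/3 * (1/3)" using that unfolding norm_mult by (intro mult_mono) auto
    moreover have "norm (z + t) < 2/3" using that norm_triangle_ineq[of z t] by simp
    moreover have "norm (1 + t * z) \<ge> 1 - norm (t * z)"
      using norm_diff_ineq[of 1 "t * z"] by simp
    ultimately have "norm (z + t) < norm (1 + t * z)" by linarith
    then show "m t z \<in> unit_disk" using nz by (simp add: m_def norm_divide)
  qed
  have hd: "(h has_field_derivative deriv h w) (at w)" if "w \<in> unit_disk" for w
    using holomorphic_derivI[OF h open_ball that] .
  have dh: "deriv h holomorphic_on unit_disk" by (rule holomorphic_deriv[OF h open_ball])
  have "((\<lambda>t. taylor_coeff ((\<lambda>t z. h (m t z)) t) n) has_field_derivative taylor_coeff (D 0) n) (at 0)"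
  proof (rule taylor_coeff_parametric_deriv[where r="1/3" and s="1/3"])
    fix t z :: complex assume tz: "t \<in> ball 0 (1/3)" "z \<in> ball 0 (1/3)"
    have "((\<lambda>t. m t z) has_field_derivative (1 - z\<^sup>2) / (1 + t * z)\<^sup>2) (at t)"
      unfolding m_def using nz[OF tz]
      by (auto intro!: derivative_eq_intros simp: power2_eq_square) (simp add: algebra_simps)
    from DERIV_chain2[OF hd[OF m[OF tz]] this]
    show "((\<lambda>t. h (m t z)) has_field_derivative D t z) (at t)" by (simp add: D_def)
  next
    have cm: "continuous_on (ball 0 (1/3) \<times> ball 0 (1/3)) (\<lambda>x. m (fst x) (snd x))"
      unfolding m_def using nz by (intro continuous_intros) auto
    have "continuous_on (ball 0 (1/3) \<times> ball 0 (1/3)) (\<lambda>x. deriv h (m (fst x) (snd x)))"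
      by (rule continuous_on_compose2[OF holomorphic_on_imp_continuous_on[OF dh] cm]) (use m in force)
    then have "continuous_on (ball 0 (1/3) \<times> ball 0 (1/3)) (\<lambda>x. D (fst x) (snd x))"
      unfolding D_def using nz by (intro continuous_intros) auto
    then show "continuous_on (ball 0 (1/3) \<times> ball 0 (1/3)) (\<lambda>(t, z). D t z)"
      by (simp add: case_prod_beta)
  next
    fix t :: complex assume t: "t \<in> ball 0 (1/3)"
    have "m t holomorphic_on ball 0 (1/3)"
      unfolding m_def using nz[OF t] by (intro holomorphic_intros) auto
    then have "h \<circ> m t holomorphic_on ball 0 (1/3)"
      by (rule holomorphic_on_compose_gen[OF _ h]) (use m[OF t] in auto)
    then show "(\<lambda>z. h (m t z)) holomorphic_on ball 0 (1/3)" by (simp add: o_def)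
  qed auto
  moreover have "D 0 = (\<lambda>z. (1 - z\<^sup>2) * deriv h z)"
    by (simp add: D_def m_def fun_eq_iff mult.commute)
  ultimately show ?thesis by (simp add: m_def)
qed

text \<open>The maximum is taken along the real axis only, so just the real part of the complex
  derivative is forced to vanish.\<close>

lemma deriv_zero_of_real_local_max:
  assumes Q: "(Q has_field_derivative D) (at 0)" and "d > 0"
    and max: "\<And>t::real. \<bar>t\<bar> < d \<Longrightarrow> Re (Q (of_real t)) \<le> Re (Q 0)"
  shows "Re D = 0"
proof -
  have "((\<lambda>t. Q (of_real t)) has_vector_derivative D) (at (0::real))"
    using has_vector_derivative_real_field[of Q D 0 UNIV] Q by simp
  then have "((\<lambda>t. Re (Q (of_real t))) has_vector_derivative Re D) (at (0::real))"
    by (rule bounded_linear.has_vector_derivative[OF bounded_linear_Re])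
  then have "((\<lambda>t. Re (Q (of_real t))) has_real_derivative Re D) (at (0::real))"
    by (simp add: has_real_derivative_iff_has_vector_derivative)
  from DERIV_local_max[OF this \<open>d > 0\<close>] max show ?thesis by auto
qed

text \<open>To first order p = 1 + 2At and q = 2Bt, so the numerator has derivative X' + 2A X(0) -
  2B Y(0) and the denominator 4A at 0; the quotient rule gives the stated combination.\<close>

lemma real_local_max_quotient:
  fixes p q X Y :: "complex \<Rightarrow> complex"
  assumes "(p has_field_derivative 2 * A) (at 0)" "(q has_field_derivative 2 * B) (at 0)"
    "(X has_field_derivative X') (at 0)" "(Y has_field_derivative Y') (at 0)"
    and "p 0 = 1" "q 0 = 0" "d > 0"
    and max: "\<And>t::real. \<bar>t\<bar> < d \<Longrightarrow>
      Re ((p t * X t - q t * Y t) / ((1 - (of_real t)\<^sup>2) * ((p t)\<^sup>2 - (q t)\<^sup>2))) \<le> Re (X 0)"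
  shows "Re (X' - 2 * A * X 0 - 2 * B * Y 0) = 0"
proof (rule deriv_zero_of_real_local_max[OF _ \<open>d > 0\<close>])
  let ?Q = "\<lambda>t. (p t * X t - q t * Y t) / ((1 - t\<^sup>2) * ((p t)\<^sup>2 - (q t)\<^sup>2))"
  show "(?Q has_field_derivative (X' - 2 * A * X 0 - 2 * B * Y 0)) (at 0)"
    using assms(5,6)
    by (auto intro!: derivative_eq_intros assms(1-4) simp: algebra_simps)
  show "Re (?Q (of_real t)) \<le> Re (?Q 0)" if "\<bar>t\<bar> < d" for t
    using max[OF that] assms(5,6) by simp
qed

text \<open>For a pair with real coefficients and a real parameter \<open>t\<close>, the Koebe transform followed by
  the affine change back into the subfamily involves no conjugations, so its coefficients
  extend to holomorphic functions of \<open>t\<close>.\<close>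

lemma real_koebe_affine_coeffs:
  fixes t :: real
  assumes F: "affine_linear_invariant F" and hg: "(h, g) \<in> harmonic_parts F"
    and re: "real_taylor h" "real_taylor g"
    and t: "\<bar>t\<bar> < 1" and n: "n > 0"
  defines "p \<equiv> deriv h (of_real t)" and "q \<equiv> deriv g (of_real t)"
    and "X \<equiv> taylor_coeff (\<lambda>z. h ((z + t) / (1 + t * z))) n"
    and "Y \<equiv> taylor_coeff (\<lambda>z. g ((z + t) / (1 + t * z))) n"
  shows "\<exists>h' g'. (h', g') \<in> harmonic_parts (zero_subfamily F) \<and>
    taylor_coeff h' n = (p * X - q * Y) / ((1 - (of_real t)\<^sup>2) * (p\<^sup>2 - q\<^sup>2)) \<and>
    taylor_coeff g' n = (p * Y - q * X) / ((1 - (of_real t)\<^sup>2) * (p\<^sup>2 - q\<^sup>2))"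
proof -
  note D = harmonic_partsD[OF F hg]
  define \<zeta> where "\<zeta> = complex_of_real t"
  have z: "norm \<zeta> < 1" using t by (simp add: \<zeta>_def)
  then have zd: "\<zeta> \<in> unit_disk" by simp
  have real_deriv: "deriv f \<zeta> \<in> \<real>" if f: "f holomorphic_on unit_disk" "real_taylor f" for f
  proof (rule holomorphic_real_on_real_axis[of "deriv f" 1 \<zeta>])
    show "deriv f holomorphic_on unit_disk" by (rule holomorphic_deriv[OF f(1) open_ball])
    fix n
    have "taylor_coeff (deriv f) n = taylor_coeff f (Suc n) * of_nat (Suc n)"
      by (simp add: taylor_coeff_def funpow_swap1 del: of_nat_Suc)
    then show "taylor_coeff (deriv f) n \<in> \<real>" using f(2) by (auto simp: real_taylor_def)
  qed (use zd in \<open>auto simp: \<zeta>_def\<close>)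
  have cp: "cnj p = p" and cq: "cnj q = q"
    using real_deriv[OF D(1) re(1)] real_deriv[OF D(2) re(2)]
    by (auto simp: p_def q_def \<zeta>_def Reals_cnj_iff)
  have p0: "p \<noteq> 0" and qp: "norm (q / p) < 1"
    using D(6) zd by (auto simp: sense_preserving_def p_def q_def \<zeta>_def)
  define s where "s = 1 - \<zeta>\<^sup>2"
  have cs: "cnj s = s" "1 - \<zeta> * cnj \<zeta> = s" by (simp_all add: s_def \<zeta>_def power2_eq_square)
  have s0: "s \<noteq> 0" using one_plus_mult_nonzero[of \<zeta> "- \<zeta>"] z by (simp add: s_def power2_eq_square)
  \<comment> \<open>First the Koebe transform with parameter \<open>t\<close>. Since
    \<open>p\<close> and \<open>s\<close> are real, both parts are divided by the same constant
    \<open>p * s\<close>.\<close>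
  define h1 where "h1 = koebe_analytic (disk_shift \<zeta>) h"
  define g1 where "g1 = koebe_coanalytic (disk_shift \<zeta>) h g"
  have z0: "disk_shift \<zeta> 0 = \<zeta>" by (simp add: disk_shift_def)
  have d: "deriv (h \<circ> disk_shift \<zeta>) 0 = p * s"
    by (simp only: deriv_compose_disk_shift[OF D(1) z] cs p_def \<zeta>_def[symmetric])
  have h1: "h1 = (\<lambda>z. (h (disk_shift \<zeta> z) - h \<zeta>) / (p * s))"
    by (simp add: h1_def koebe_analytic_def[abs_def] d z0)
  have g1: "g1 = (\<lambda>z. (g (disk_shift \<zeta> z) - g \<zeta>) / (p * s))"
    by (simp add: g1_def koebe_coanalytic_def[abs_def] d z0 cp cs)
  have hg1: "(h1, g1) \<in> harmonic_parts F"
    using koebe_admissible_disk_shift[OF F z] hg unfolding koebe_admissible_def h1_def g1_def by blast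
  note D1 = harmonic_partsD[OF F hg1]
  have hs: "(\<lambda>z. f (disk_shift \<zeta> z)) holomorphic_on unit_disk" if "f holomorphic_on unit_disk" for f
    using holomorphic_on_compose_gen[OF disk_shift_holomorphic[OF z] that] disk_shift_in_disk[OF z]
    by (force simp: o_def)
  have Y: "taylor_coeff (\<lambda>z. g (disk_shift \<zeta> z)) n = Y"
    by (simp add: Y_def disk_shift_def \<zeta>_def)
  have ch1: "taylor_coeff h1 n = X / (p * s)"
    using taylor_coeff_affine[OF hs[OF D(1)] zero_less_one n] by (simp add: h1 X_def disk_shift_def \<zeta>_def)
  have cg1: "taylor_coeff g1 k = taylor_coeff (\<lambda>z. g (disk_shift \<zeta> z)) k / (p * s)" if "k > 0" for k
    using taylor_coeff_affine[OF hs[OF D(2)] zero_less_one that] by (simp add: g1)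
  have "deriv g1 0 = deriv (g \<circ> disk_shift \<zeta>) 0 / (p * s)"
    using cg1[of 1] by (simp add: taylor_coeff_1 o_def)
  also have "\<dots> = q / p"
    using s0 by (simp add: deriv_compose_disk_shift[OF D(2) z] cs q_def \<zeta>_def[symmetric])
  finally have b: "deriv g1 0 = q / p" .
  \<comment> \<open>Then the normalizing affine change; its parameter \<open>q / p\<close>, the new
    derivative of the coanalytic part at 0, is real as well.\<close>
  let ?h = "\<lambda>z. (h1 z - q / p * g1 z) / (1 - q / p * (q / p))"
  let ?g = "\<lambda>z. (g1 z - q / p * h1 z) / (1 - q / p * (q / p))"
  have "(?h, ?g) \<in> harmonic_parts (zero_subfamily F)"
    using harmonic_parts_normalize(2)[OF F hg1] by (simp add: b cp cq)
  moreover have "1 - q / p * (q / p) \<noteq> 0"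
    using one_plus_mult_nonzero[of "q / p" "- (q / p)"] qp by simp
  then have e0: "p\<^sup>2 - q\<^sup>2 \<noteq> 0" "(1 - q / p * (q / p)) = (p\<^sup>2 - q\<^sup>2) / p\<^sup>2"
    using p0 by (auto simp: field_simps power2_eq_square)
  have lin: "taylor_coeff (\<lambda>z. (u z - q / p * v z) / c) n = (taylor_coeff u n - q / p * taylor_coeff v n) / c"
    if "u holomorphic_on unit_disk" "v holomorphic_on unit_disk" for u v c
    using taylor_coeff_linear[OF that zero_less_one, of "1 / c" "- (q / p / c)" n]
    by (simp add: diff_divide_distrib)
  have "taylor_coeff ?h n = (X / (p * s) - q / p * (Y / (p * s))) / ((p\<^sup>2 - q\<^sup>2) / p\<^sup>2)"
    "taylor_coeff ?g n = (Y / (p * s) - q / p * (X / (p * s))) / ((p\<^sup>2 - q\<^sup>2) / p\<^sup>2)"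
    unfolding lin[OF D1(1,2)] lin[OF D1(2,1)] ch1 cg1[OF n] Y e0(2) by (rule refl)+
  then have "taylor_coeff ?h n = (p * X - q * Y) / (s * (p\<^sup>2 - q\<^sup>2))"
    "taylor_coeff ?g n = (p * Y - q * X) / (s * (p\<^sup>2 - q\<^sup>2))"
    using p0 s0 e0(1) by (auto simp: divide_simps power2_eq_square)
  ultimately show ?thesis unfolding s_def \<zeta>_def by blast
qed

text \<open>The competitors built from real \<open>t\<close> stay in the subfamily and give back the
  extremal coefficient at \<open>t = 0\<close>, so \<open>t = 0\<close> is stationary. The second
  part exchanges the roles of the two coefficient functions.\<close>

lemma extremal_coeff_relation:
  assumes F: "affine_linear_invariant F" and hg: "(h, g) \<in> harmonic_parts (zero_subfamily F)"
    and re: "real_taylor h" "real_taylor g" and n: "n > 0"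
  shows "(\<And>h' g'. (h', g') \<in> harmonic_parts (zero_subfamily F) \<Longrightarrow>
        Re (taylor_coeff h' n) \<le> Re (taylor_coeff h n)) \<Longrightarrow>
      Re (taylor_coeff (\<lambda>z. (1 - z\<^sup>2) * deriv h z) n - 2 * taylor_coeff h 2 * taylor_coeff h n
          - 2 * taylor_coeff g 2 * taylor_coeff g n) = 0"
    and "(\<And>h' g'. (h', g') \<in> harmonic_parts (zero_subfamily F) \<Longrightarrow>
        Re (taylor_coeff g' n) \<le> Re (taylor_coeff g n)) \<Longrightarrow>
      Re (taylor_coeff (\<lambda>z. (1 - z\<^sup>2) * deriv g z) n - 2 * taylor_coeff h 2 * taylor_coeff g n
          - 2 * taylor_coeff g 2 * taylor_coeff h n) = 0"
proof -
  have hg': "(h, g) \<in> harmonic_parts F" "deriv g 0 = 0"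
    using hg by (auto simp: harmonic_parts_zero_subfamily_iff)
  note D = harmonic_partsD[OF F hg'(1)]
  define C where "C = (\<lambda>f t. taylor_coeff (\<lambda>z. f ((z + t) / (1 + t * z))) n)"
  have C0: "C f 0 = taylor_coeff f n" for f by (simp add: C_def)
  have CD: "(C f has_field_derivative taylor_coeff (\<lambda>z. (1 - z\<^sup>2) * deriv f z) n) (at 0)"
    if "f holomorphic_on unit_disk" for f
    using taylor_coeff_disk_shift_deriv[OF that] by (simp add: C_def)
  have d2: "(deriv f has_field_derivative 2 * taylor_coeff f 2) (at 0)"
    if "f holomorphic_on unit_disk" for f
    using holomorphic_derivI[OF holomorphic_deriv[OF that open_ball] open_ball, of 0]
    by (simp add: taylor_coeff_def numeral_2_eq_2)
  note koebe = real_koebe_affine_coeffs[OF F hg'(1) re _ n]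
  show "Re (taylor_coeff (\<lambda>z. (1 - z\<^sup>2) * deriv h z) n - 2 * taylor_coeff h 2 * taylor_coeff h n
          - 2 * taylor_coeff g 2 * taylor_coeff g n) = 0"
    if max: "\<And>h' g'. (h', g') \<in> harmonic_parts (zero_subfamily F) \<Longrightarrow>
        Re (taylor_coeff h' n) \<le> Re (taylor_coeff h n)"
    unfolding C0[symmetric, of h] C0[symmetric, of g]
  proof (rule real_local_max_quotient[OF d2[OF D(1)] d2[OF D(2)] CD[OF D(1)] CD[OF D(2)] D(5) hg'(2) zero_less_one])
    fix t :: real assume "\<bar>t\<bar> < 1"
    from koebe[OF this] max
    show "Re ((deriv h t * C h t - deriv g t * C g t) / ((1 - (of_real t)\<^sup>2) * ((deriv h t)\<^sup>2 - (deriv g t)\<^sup>2)))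
        \<le> Re (C h 0)"
      unfolding C0 by (metis C_def)
  qed
  show "Re (taylor_coeff (\<lambda>z. (1 - z\<^sup>2) * deriv g z) n - 2 * taylor_coeff h 2 * taylor_coeff g n
          - 2 * taylor_coeff g 2 * taylor_coeff h n) = 0"
    if max: "\<And>h' g'. (h', g') \<in> harmonic_parts (zero_subfamily F) \<Longrightarrow>
        Re (taylor_coeff g' n) \<le> Re (taylor_coeff g n)"
    unfolding C0[symmetric, of h] C0[symmetric, of g]
  proof (rule real_local_max_quotient[OF d2[OF D(1)] d2[OF D(2)] CD[OF D(2)] CD[OF D(1)] D(5) hg'(2) zero_less_one])
    fix t :: real assume "\<bar>t\<bar> < 1"
    from koebe[OF this] max
    show "Re ((deriv h t * C g t - deriv g t * C h t) / ((1 - (of_real t)\<^sup>2) * ((deriv h t)\<^sup>2 - (deriv g t)\<^sup>2)))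
        \<le> Re (C g 0)"
      unfolding C0 by (metis C_def)
  qed
qed

subsection \<open>Generalized Koebe functions\<close>

lemma disk_to_half_plane:
  assumes "z \<in> unit_disk"
  shows "1 - z \<noteq> 0" "Re ((1 + z) / (1 - z)) > 0" "1 - z\<^sup>2 \<noteq> 0"
proof -
  have z: "norm z < 1" using assms by simp
  then show nz: "1 - z \<noteq> 0" by auto
  have "(1 + z) * cnj (1 - z) = 1 - z * cnj z + (z - cnj z)" by (simp add: algebra_simps)
  then have "Re ((1 + z) * cnj (1 - z)) = 1 - (norm z)\<^sup>2"
    unfolding cmod_power2 by (simp add: power2_eq_square)
  moreover have "(norm z)\<^sup>2 < 1" using z by (simp add: abs_square_less_1)
  ultimately show "Re ((1 + z) / (1 - z)) > 0" unfolding Re_complex_div_gt_0 by simp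
  show "1 - z\<^sup>2 \<noteq> 0"
    using one_plus_mult_nonzero[of z "- z"] z by (simp add: power2_eq_square)
qed

text \<open>The logarithm shared by \<open>gen_koebe\<close> and \<open>lens_map\<close>: powers of
  (1 + z) / (1 - z) become exponentials of its multiples, and its derivative 2 / (1 - z^2) fits the
  factor 1 - z^2 in the differential equations.\<close>

definition half_plane_log :: "complex \<Rightarrow> complex" where
  "half_plane_log z = Ln ((1 + z) / (1 - z))"

lemma half_plane_log_0: "half_plane_log 0 = 0"
  by (simp add: half_plane_log_def)

lemma powr_eq_exp_half_plane_log:
  assumes "z \<in> unit_disk"
  shows "((1 + z) / (1 - z)) powr a = exp (a * half_plane_log z)"
proof -
  have "(1 + z) / (1 - z) \<noteq> 0" using disk_to_half_plane(2)[OF assms] by force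
  then show ?thesis by (simp only: powr_def half_plane_log_def if_False)
qed

lemma half_plane_log_derivative:
  assumes "z \<in> unit_disk"
  shows "(half_plane_log has_field_derivative 2 / (1 - z\<^sup>2)) (at z)"
proof -
  note z = disk_to_half_plane[OF assms]
  have z': "1 + z \<noteq> 0" using z(2) by auto
  have "(1 + z) / (1 - z) \<notin> \<real>\<^sub>\<le>\<^sub>0" using z(2) complex_nonpos_Reals_iff by force
  moreover have "((\<lambda>z. (1 + z) / (1 - z)) has_field_derivative 2 / (1 - z)\<^sup>2) (at z)"
    using z(1) by (auto intro!: derivative_eq_intros simp: power2_eq_square)
  ultimately have "(half_plane_log has_field_derivative inverse ((1 + z) / (1 - z)) * (2 / (1 - z)\<^sup>2)) (at z)"
    unfolding half_plane_log_def by (intro DERIV_chain2[of Ln] has_field_derivative_Ln)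
  moreover have "inverse ((1 + z) / (1 - z)) * (2 / (1 - z)\<^sup>2) = 2 / ((1 - z) * (1 + z))"
  proof -
    have "inverse (x / y) * (2 / y\<^sup>2) = 2 / (y * x)" if "x \<noteq> 0" "y \<noteq> 0" for x y :: complex
      using that by (simp add: power2_eq_square)
    then show ?thesis using z(1) z' by blast
  qed
  moreover have "(1 - z) * (1 + z) = 1 - z\<^sup>2" by (simp add: power2_eq_square algebra_simps)
  ultimately show ?thesis by simp
qed

text \<open>Integrating factor: the product of 1 + 2 a P with
  \<open>exp (- (a * half_plane_log z))\<close> has derivative zero and value 1 at 0.\<close>

lemma koebe_ode_solution:
  assumes P: "P holomorphic_on unit_disk" "P 0 = 0"
    and ode: "\<And>z. z \<in> unit_disk \<Longrightarrow> (1 - z\<^sup>2) * deriv P z = 1 + 2 * a * P z"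
    and z: "z \<in> unit_disk"
  shows "(1 - z\<^sup>2) * deriv P z = exp (a * half_plane_log z)" "P z = gen_koebe a z"
proof -
  have const: "\<Phi> z = \<Phi> 0" if 0: "\<And>z. z \<in> unit_disk \<Longrightarrow> (\<Phi> has_field_derivative 0) (at z)" for \<Phi> :: "complex \<Rightarrow> complex"
  proof -
    have "(\<Phi> has_field_derivative 0) (at z within unit_disk)" if "z \<in> unit_disk" for z
      using 0[OF that] by (rule DERIV_subset) simp
    then obtain c where "\<And>z. z \<in> unit_disk \<Longrightarrow> \<Phi> z = c"
      using has_field_derivative_zero_constant[of unit_disk \<Phi>] by auto
    then show ?thesis using z by auto
  qed
  have P': "(P has_field_derivative deriv P z) (at z)" if "z \<in> unit_disk" for z
    using holomorphic_derivI[OF P(1) open_ball that] .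
  define \<Phi> where "\<Phi> = (\<lambda>z. (1 + 2 * a * P z) * exp (- (a * half_plane_log z)))"
  have "\<Phi> z = \<Phi> 0"
  proof (rule const)
    fix z assume z: "z \<in> unit_disk"
    have "(\<Phi> has_field_derivative 
        2 * a * (deriv P z - (1 + 2 * a * P z) / (1 - z\<^sup>2)) * exp (- (a * half_plane_log z))) (at z)"
      unfolding \<Phi>_def
      by (auto intro!: derivative_eq_intros P'[OF z] half_plane_log_derivative[OF z])
        (simp add: algebra_simps)
    moreover have "deriv P z - (1 + 2 * a * P z) / (1 - z\<^sup>2) = 0"
      using ode[OF z] disk_to_half_plane(3)[OF z] by (simp add: field_simps)
    ultimately show "(\<Phi> has_field_derivative 0) (at z)" by simp
  qed
  then have e: "1 + 2 * a * P z = exp (a * half_plane_log z)"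
    by (simp add: \<Phi>_def P(2) half_plane_log_0 exp_minus field_simps)
  then show "(1 - z\<^sup>2) * deriv P z = exp (a * half_plane_log z)" using ode[OF z] by simp
  show "P z = gen_koebe a z"
  proof (cases "a = 0")
    case True
    \<comment> \<open>For \<open>a = 0\<close> the previous identity reads 1 = 1 and does not
      determine \<open>P\<close>, so the equation is integrated directly.\<close>
    have "P z - 1 / 2 * half_plane_log z = P 0 - 1 / 2 * half_plane_log 0"
    proof (rule const)
      fix z assume z: "z \<in> unit_disk"
      have "deriv P z - 1 / 2 * (2 / (1 - z\<^sup>2)) = 0"
        using ode[OF z] disk_to_half_plane(3)[OF z] True by (simp add: field_simps)
      moreover have "((\<lambda>z. P z - 1 / 2 * half_plane_log z) has_field_derivative
          deriv P z - 1 / 2 * (2 / (1 - z\<^sup>2))) (at z)"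
        by (intro DERIV_diff DERIV_cmult P'[OF z] half_plane_log_derivative[OF z])
      ultimately show "((\<lambda>z. P z - 1 / 2 * half_plane_log z) has_field_derivative 0) (at z)" by simp
    qed
    then have "P z = 1 / 2 * half_plane_log z" by (simp add: P(2) half_plane_log_0)
    then show ?thesis by (simp add: gen_koebe_def True half_plane_log_def)
  next
    case False
    then show ?thesis
      using e by (simp add: gen_koebe_def powr_eq_exp_half_plane_log[OF z] field_simps)
  qed
qed

text \<open>The difference and the sum of \<open>h\<close> and \<open>g\<close> solve scalar
  equations with parameters A - B and A + B. Hence (h' + g') / (h' - g') is E =
  \<open>exp (2 * B * half_plane_log z)\<close>, and g' / h' = (E - 1) / (E + 1).\<close>

lemma koebe_system_dilatation:
  assumes hol: "h holomorphic_on unit_disk" "g holomorphic_on unit_disk" "h 0 = 0" "g 0 = 0"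
    and h: "\<And>z. z \<in> unit_disk \<Longrightarrow> (1 - z\<^sup>2) * deriv h z = 1 + 2 * A * h z + 2 * B * g z"
    and g: "\<And>z. z \<in> unit_disk \<Longrightarrow> (1 - z\<^sup>2) * deriv g z = 2 * A * g z + 2 * B * h z"
    and z: "z \<in> unit_disk"
  shows "h z - g z = gen_koebe (A - B) z"
    "deriv h z \<noteq> 0 \<Longrightarrow> exp (2 * B * half_plane_log z) + 1 \<noteq> 0"
    "deriv g z / deriv h z = (exp (2 * B * half_plane_log z) - 1) / (exp (2 * B * half_plane_log z) + 1)"
proof -
  have d: "deriv (\<lambda>z. h z - g z) z = deriv h z - deriv g z"
    "deriv (\<lambda>z. h z + g z) z = deriv h z + deriv g z" if "z \<in> unit_disk" for z
    using holomorphic_on_imp_differentiable_at[OF hol(1) open_ball that]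
      holomorphic_on_imp_differentiable_at[OF hol(2) open_ball that] by simp_all
  have om: "(1 - z\<^sup>2) * deriv (\<lambda>z. h z - g z) z = 1 + 2 * (A - B) * (h z - g z)"
    if "z \<in> unit_disk" for z
    unfolding d(1)[OF that] right_diff_distrib[of "1 - z\<^sup>2"] h[OF that] g[OF that]
    by (simp add: algebra_simps)
  have op: "(1 - z\<^sup>2) * deriv (\<lambda>z. h z + g z) z = 1 + 2 * (A + B) * (h z + g z)"
    if "z \<in> unit_disk" for z
    unfolding d(2)[OF that] distrib_left[of "1 - z\<^sup>2"] h[OF that] g[OF that]
    by (simp add: algebra_simps)
  have hm: "(\<lambda>z. h z - g z) holomorphic_on unit_disk" "h 0 - g 0 = 0"
    and hp: "(\<lambda>z. h z + g z) holomorphic_on unit_disk" "h 0 + g 0 = 0"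
    using hol by (auto intro: holomorphic_intros)
  show "h z - g z = gen_koebe (A - B) z"
    by (rule koebe_ode_solution(2)[OF hm om z])
  define s where "s = 1 - z\<^sup>2"
  have "s \<noteq> 0" using disk_to_half_plane(3)[OF z] by (simp add: s_def)
  define E where "E = exp (2 * B * half_plane_log z)"
  define e where "e = exp ((A - B) * half_plane_log z)"
  have "e \<noteq> 0" by (simp add: e_def)
  have m: "s * (deriv h z - deriv g z) = e"
    using koebe_ode_solution(1)[OF hm om z] by (simp add: d[OF z] s_def e_def)
  have "exp ((A + B) * half_plane_log z) = E * e"
    unfolding E_def e_def exp_add[symmetric] by (simp add: algebra_simps)
  then have p: "s * (deriv h z + deriv g z) = E * e"
    using koebe_ode_solution(1)[OF hp op z] by (simp add: d[OF z] s_def)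
  have "s * (2 * deriv h z) = s * (deriv h z + deriv g z) + s * (deriv h z - deriv g z)"
    "s * (2 * deriv g z) = s * (deriv h z + deriv g z) - s * (deriv h z - deriv g z)"
    by (simp_all add: algebra_simps)
  then have "s * (2 * deriv h z) = (E + 1) * e" "s * (2 * deriv g z) = (E - 1) * e"
    unfolding m p by (simp_all add: algebra_simps)
  then have dh: "deriv h z = (E + 1) * (e / (2 * s))" and dg: "deriv g z = (E - 1) * (e / (2 * s))"
    using \<open>s \<noteq> 0\<close> by (simp_all add: field_simps)
  show "deriv h z \<noteq> 0 \<Longrightarrow> exp (2 * B * half_plane_log z) + 1 \<noteq> 0"
    using dh by (auto simp: E_def)
  show "deriv g z / deriv h z = (exp (2 * B * half_plane_log z) - 1) / (exp (2 * B * half_plane_log z) + 1)"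
    unfolding E_def[symmetric] dh dg using \<open>e \<noteq> 0\<close> \<open>s \<noteq> 0\<close> by simp
qed

text \<open>The special cases fit the general formula: for \<open>R = 1\<close> the quotient
  simplifies to z, and for \<open>R = 0\<close> its numerator vanishes.\<close>

lemma lens_map_eq:
  assumes z: "z \<in> unit_disk"
  shows "lens_map R z =
    (exp (of_real R * half_plane_log z) - 1) / (exp (of_real R * half_plane_log z) + 1)"
proof (cases "R = 1")
  case True
  note nz = disk_to_half_plane[OF z]
  have "(1 + z) / (1 - z) \<noteq> 0" using nz(2) by force
  then have "exp (half_plane_log z) = (1 + z) / (1 - z)" by (simp add: half_plane_log_def)
  moreover have "((1 + z) / (1 - z) - 1) / ((1 + z) / (1 - z) + 1) = z"
  proof -
    have "(1 + z) / (1 - z) - 1 = 2 * z / (1 - z)" "(1 + z) / (1 - z) + 1 = 2 / (1 - z)"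
      using nz(1) by (simp_all add: field_simps)
    then show ?thesis using nz(1) by simp
  qed
  ultimately show ?thesis using True by (simp add: lens_map_def)
qed (simp add: lens_map_def powr_eq_exp_half_plane_log[OF z])

text \<open>If R > 1, some unimodular w in the right half-plane has w^R equal to the imaginary unit;
  at the corresponding point of the disk the quotient has modulus 1.\<close>

lemma dilatation_exponent_le_1:
  fixes R :: real
  assumes "\<And>z. z \<in> unit_disk \<Longrightarrow> exp (of_real R * half_plane_log z) + 1 \<noteq> 0 \<and>
    norm ((exp (of_real R * half_plane_log z) - 1) / (exp (of_real R * half_plane_log z) + 1)) < 1"
  shows "R \<le> 1"
proof (rule ccontr)
  assume "\<not> R \<le> 1"
  then have "R > 1" by simp
  define \<theta> where "\<theta> = pi / (2 * R)"
  have \<theta>: "0 < \<theta>" "\<theta> < pi / 2" using \<open>R > 1\<close> by (auto simp: \<theta>_def field_simps)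
  define w where "w = cis \<theta>"
  have "Re w > 0" using \<theta> by (simp add: w_def cos_gt_zero)
  then have w1: "w + 1 \<noteq> 0" by (auto simp: complex_eq_iff)
  \<comment> \<open>The inverse of the map z to (1 + z) / (1 - z), evaluated at
    \<open>w\<close>.\<close>
  define z where "z = (w - 1) / (w + 1)"
  have "(norm (w - 1))\<^sup>2 < (norm (w + 1))\<^sup>2"
    using \<open>Re w > 0\<close> unfolding cmod_power2 by (simp add: power2_eq_square algebra_simps)
  then have "norm (w - 1) < norm (w + 1)" by (rule power2_less_imp_less) simp
  then have z: "z \<in> unit_disk" using w1 by (simp add: z_def norm_divide)
  have "1 + z = 2 * w / (w + 1)" "1 - z = 2 / (w + 1)" using w1 by (simp_all add: z_def field_simps)
  then have "(1 + z) / (1 - z) = w" using w1 by simp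
  then have "half_plane_log z = Ln w" by (simp only: half_plane_log_def)
  also have "\<dots> = \<i> * \<theta>"
    unfolding w_def cis_conv_exp using \<theta> by (intro Ln_exp) auto
  finally have "of_real R * half_plane_log z = \<i> * of_real (pi / 2)"
    using \<open>R > 1\<close> by (simp add: \<theta>_def field_simps)
  then have "exp (of_real R * half_plane_log z) = \<i>"
    by (metis cis_conv_exp cis_pi_half)
  with assms[OF z] have "norm ((\<i> - 1) / (\<i> + 1)) < 1" by simp
  moreover have "norm (\<i> - 1) = norm (\<i> + 1)" by (simp add: cmod_def)
  moreover have "\<i> + 1 \<noteq> 0" by (simp add: complex_eq_iff)
  ultimately show False by (simp add: norm_divide)
qed

text \<open>Inverting the normalization writes any \<open>h\<close> as h1 + cnj b g1 with (h1, g1)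
  in the subfamily and |b| < 1, which bounds the coefficient by A + B. Affine changes of the
  extremal pair come arbitrarily close to this bound.\<close>

lemma family_order_eqI:
  fixes A B :: real
  assumes F: "affine_linear_invariant F" and hg0: "(h0, g0) \<in> harmonic_parts (zero_subfamily F)"
    and A0: "taylor_coeff h0 2 = of_real A" and B0: "taylor_coeff g0 2 = of_real B"
    and A: "\<And>h g. (h, g) \<in> harmonic_parts (zero_subfamily F) \<Longrightarrow> norm (taylor_coeff h 2) \<le> A"
    and B: "\<And>h g. (h, g) \<in> harmonic_parts (zero_subfamily F) \<Longrightarrow> norm (taylor_coeff g 2) \<le> B"
  shows "family_order F = ereal (A + B)"
  unfolding family_order_def
proof (rule antisym)
  have lin: "taylor_coeff (\<lambda>z. (u z - a * v z) / c) 2 = (taylor_coeff u 2 - a * taylor_coeff v 2) / c"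
    if "u holomorphic_on unit_disk" "v holomorphic_on unit_disk" for u v a c
    using taylor_coeff_linear[OF that zero_less_one, of "1 / c" "- (a / c)" 2]
    by (simp add: diff_divide_distrib)
  have AB: "A \<ge> 0" "B \<ge> 0" using A[OF hg0] B[OF hg0] norm_ge_zero order_trans by blast+
  have "norm (taylor_coeff h 2) \<le> A + B" if hg: "(h, g) \<in> harmonic_parts F" for h g
  proof -
    note D = harmonic_partsD[OF F hg]
    define b where "b = deriv g 0"
    define h1 where "h1 = (\<lambda>z. (h z - cnj b * g z) / (1 - cnj b * b))"
    define g1 where "g1 = (\<lambda>z. (g z - b * h z) / (1 - cnj b * b))"
    have b: "norm b < 1" and hg1: "(h1, g1) \<in> harmonic_parts (zero_subfamily F)"
      using harmonic_parts_normalize[OF F hg] by (simp_all add: b_def h1_def g1_def)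
    have nz: "1 - cnj b * b \<noteq> 0" using one_plus_mult_nonzero[of "cnj b" "- b"] b by simp
    have "taylor_coeff h1 2 + cnj b * taylor_coeff g1 2 =
        ((1 - cnj b * b) * taylor_coeff h 2) / (1 - cnj b * b)"
      unfolding h1_def g1_def lin[OF D(1,2)] lin[OF D(2,1)]
      by (simp add: add_divide_distrib[symmetric] algebra_simps)
    then have "taylor_coeff h 2 = taylor_coeff h1 2 + cnj b * taylor_coeff g1 2" using nz by simp
    then have "norm (taylor_coeff h 2) \<le> norm (taylor_coeff h1 2) + norm b * norm (taylor_coeff g1 2)"
      by (metis norm_triangle_ineq norm_mult complex_mod_cnj)
    also have "norm b * norm (taylor_coeff g1 2) \<le> 1 * norm (taylor_coeff g1 2)"
      using b by (intro mult_right_mono) auto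
    finally show ?thesis using A[OF hg1] B[OF hg1] by linarith
  qed
  then show "(SUP (h, g) \<in> harmonic_parts F. ereal (norm (taylor_coeff h 2))) \<le> ereal (A + B)"
    by (intro SUP_least) auto
  let ?S = "SUP (h, g) \<in> harmonic_parts F. ereal (norm (taylor_coeff h 2))"
  have hg0': "(h0, g0) \<in> harmonic_parts F" "deriv g0 0 = 0"
    using hg0 by (auto simp: harmonic_parts_zero_subfamily_iff)
  note D = harmonic_partsD[OF F hg0'(1)]
  have "ereal (A + \<epsilon> * B) \<le> ?S" if "0 < \<epsilon>" "\<epsilon> < 1" for \<epsilon> :: real
  proof -
    \<comment> \<open>The parameter is negative so that the coefficients add up to A + \<epsilon> B;
      the denominator is 1 because g0'(0) = 0.\<close>
    have "(\<lambda>z. (h0 z - cnj (- of_real \<epsilon>) * g0 z) / 1, \<lambda>z. (g0 z - (- of_real \<epsilon>) * h0 z) / 1)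
        \<in> harmonic_parts F" (is "(?h, ?g) \<in> _")
      using harmonic_parts_affine_change[OF F hg0'(1), of "- of_real \<epsilon>"] that by (simp add: hg0'(2))
    then have "(\<lambda>(h, g). ereal (norm (taylor_coeff h 2))) (?h, ?g) \<le> ?S" by (rule SUP_upper)
    moreover have "taylor_coeff ?h 2 = of_real (A + \<epsilon> * B)"
      unfolding lin[OF D(1,2)] A0 B0 by simp
    then have "norm (taylor_coeff ?h 2) = A + \<epsilon> * B"
      using AB that by (simp only: norm_of_real) simp
    ultimately show ?thesis by simp
  qed
  \<comment> \<open>Affine changes require a parameter of modulus below 1, so A + B is approached
    from the left.\<close>
  moreover have "((\<lambda>\<epsilon>. ereal (A + \<epsilon> * B)) \<longlongrightarrow> ereal (A + 1 * B)) (at_left 1)"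
    by (intro tendsto_intros)
  moreover have "eventually (\<lambda>\<epsilon>::real. \<epsilon> \<in> {0<..<1}) (at_left 1)"
    by (intro eventually_at_left_real) simp
  then have "eventually (\<lambda>\<epsilon>::real. ereal (A + \<epsilon> * B) \<le> ?S) (at_left 1)"
    by (rule eventually_mono) (use calculation(1) in auto)
  ultimately have "ereal (A + 1 * B) \<le> ?S"
    by (intro tendsto_upperbound[where F = "at_left (1::real)"]) auto
  then show "ereal (A + B) \<le> ?S" by simp
qed

section \<open>The extremal pair and its differential system\<close>

theorem theorem2:
  fixes F :: "(complex \<Rightarrow> complex) set" and f0 h0 g0 :: "complex \<Rightarrow> complex"
  assumes "affine_linear_invariant F"
    and "f0 \<in> zero_subfamily F"
    and "harmonic_repr f0 h0 g0"
    and "\<And>n. n \<ge> 2 \<Longrightarrow> \<exists>s::real.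
           (SUP (h, g) \<in> harmonic_parts (zero_subfamily F). ereal (Re (taylor_coeff h n))) = ereal s \<and>
           taylor_coeff h0 n = complex_of_real s"
    and "\<And>n. n \<ge> 2 \<Longrightarrow> \<exists>s::real.
           (SUP (h, g) \<in> harmonic_parts (zero_subfamily F). ereal (Re (taylor_coeff g n))) = ereal s \<and>
           taylor_coeff g0 n = complex_of_real s"
  shows "\<exists>a R :: real. 0 \<le> R \<and> R \<le> 1 \<and> is_gen_harmonic_koebe a R f0 \<and>
           family_order F = ereal (a + R)"
proof -
  note F = assms(1)
  let ?P0 = "harmonic_parts (zero_subfamily F)"
  have hg0: "(h0, g0) \<in> ?P0" using assms(2,3) by (auto simp: harmonic_parts_def)
  then have hg: "(h0, g0) \<in> harmonic_parts F" "deriv g0 0 = 0"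
    by (auto simp: harmonic_parts_zero_subfamily_iff)
  note D = harmonic_partsD[OF F hg(1)]
  have hmax: "Re (taylor_coeff h n) \<le> Re (taylor_coeff h0 n)" and hreal: "taylor_coeff h0 n \<in> \<real>"
    if "n \<ge> 2" "(h, g) \<in> ?P0" for n h g
    using assms(4)[OF that(1)] SUP_upper[OF that(2), of "\<lambda>(h, g). ereal (Re (taylor_coeff h n))"] by auto
  have gmax: "Re (taylor_coeff g n) \<le> Re (taylor_coeff g0 n)" and greal: "taylor_coeff g0 n \<in> \<real>"
    if "n \<ge> 2" "(h, g) \<in> ?P0" for n h g
    using assms(5)[OF that(1)] SUP_upper[OF that(2), of "\<lambda>(h, g). ereal (Re (taylor_coeff g n))"] by auto
  have low: "taylor_coeff h0 0 = 0" "taylor_coeff h0 1 = 1" "taylor_coeff g0 0 = 0" "taylor_coeff g0 1 = 0"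
    using D hg(2) by (simp_all add: taylor_coeff_0 taylor_coeff_1)
  \<comment> \<open>Extremality is given from \<open>n = 2\<close> on; the coefficients of index 0
    and 1 are fixed by the normalizations, hence also real.\<close>
  have small: "n = 0 \<or> n = 1 \<or> n \<ge> 2" for n :: nat by auto
  have re: "taylor_coeff h0 n \<in> \<real>" "taylor_coeff g0 n \<in> \<real>" for n
    using small[of n] low hreal[OF _ hg0] greal[OF _ hg0] by auto
  then have ret: "real_taylor h0" "real_taylor g0" by (auto simp: real_taylor_def)
  obtain A B :: real where A: "taylor_coeff h0 2 = of_real A" and B: "taylor_coeff g0 2 = of_real B"
    using re by (metis Reals_cases)
  have bounds: "norm (taylor_coeff h 2) \<le> A" "norm (taylor_coeff g 2) \<le> B" if "(h, g) \<in> ?P0" for h g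
    using zero_subfamily_second_coeff_bounds[OF F that, of A B] hmax[of 2] gmax[of 2] A B by auto
  have "B \<ge> 0" using bounds(2)[OF hg0] norm_ge_zero order_trans by blast
  have order: "family_order F = ereal (A + B)"
    by (rule family_order_eqI[OF F hg0 A B bounds])
  \<comment> \<open>Both differential equations at once: \<open>c = 1\<close> is the equation for
    \<open>h0\<close>, and \<open>c = 0\<close> the one for \<open>g0\<close> with the two functions
    exchanged. The condition on the second coefficient of \<open>u\<close> selects A or B
    accordingly.\<close>
  have system: "(1 - z\<^sup>2) * deriv u z = c + 2 * of_real A * u z + 2 * of_real B * v z"
    if z: "z \<in> unit_disk" and hol: "u holomorphic_on unit_disk" "v holomorphic_on unit_disk"
      and low: "taylor_coeff u 0 = 0" "taylor_coeff v 0 = 0" "taylor_coeff v 1 = 1 - c" "taylor_coeff u 1 = c"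
      and u2: "taylor_coeff u 2 = of_real (Re c * A + (1 - Re c) * B)" and c: "c = 0 \<or> c = 1"
      and real: "\<And>n. taylor_coeff u n \<in> \<real>" "\<And>n. taylor_coeff v n \<in> \<real>"
      and eq: "\<And>n. n \<ge> 2 \<Longrightarrow> Re (taylor_coeff (\<lambda>z. (1 - z\<^sup>2) * deriv u z) n
        - 2 * of_real A * taylor_coeff u n - 2 * of_real B * taylor_coeff v n) = 0"
    for u v c z
  proof (rule holomorphic_eq_taylor[where r = 1 and z = z and f = "\<lambda>z. (1 - z\<^sup>2) * deriv u z"
        and g = "\<lambda>z. c + 2 * of_real A * u z + 2 * of_real B * v z"])
    show "(\<lambda>z. (1 - z\<^sup>2) * deriv u z) holomorphic_on unit_disk"
      by (intro holomorphic_intros holomorphic_deriv[OF hol(1)] open_ball)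
    show "(\<lambda>z. c + 2 * of_real A * u z + 2 * of_real B * v z) holomorphic_on unit_disk"
      by (intro holomorphic_intros hol)
    fix n
    have L: "taylor_coeff (\<lambda>z. (1 - z\<^sup>2) * deriv u z) n =
        of_nat (Suc n) * taylor_coeff u (Suc n) - of_nat (n - 1) * taylor_coeff u (n - 1)"
      by (rule taylor_coeff_koebe_deriv[OF hol(1)]) simp
    have "taylor_coeff (\<lambda>z. 1 * (c * 1 + (2 * of_real A) * u z) + 2 * of_real B * v z) n =
        1 * taylor_coeff (\<lambda>z. c * 1 + (2 * of_real A) * u z) n + 2 * of_real B * taylor_coeff v n"
      using hol by (intro taylor_coeff_linear[of _ 1]) (auto intro!: holomorphic_intros)
    also have "taylor_coeff (\<lambda>z. c * 1 + (2 * of_real A) * u z) n =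
        c * taylor_coeff (\<lambda>_. 1) n + 2 * of_real A * taylor_coeff u n"
      using hol by (intro taylor_coeff_linear[of _ 1]) auto
    also have "taylor_coeff (\<lambda>_. 1) n = (if n = 0 then 1 else 0)"
      using taylor_coeff_eqI[OF has_fps_expansion_1, of n] by simp
    finally have R: "taylor_coeff (\<lambda>z. c + 2 * of_real A * u z + 2 * of_real B * v z) n =
        (if n = 0 then c else 0) + 2 * of_real A * taylor_coeff u n + 2 * of_real B * taylor_coeff v n"
      by simp
    show "taylor_coeff (\<lambda>z. (1 - z\<^sup>2) * deriv u z) n =
        taylor_coeff (\<lambda>z. c + 2 * of_real A * u z + 2 * of_real B * v z) n"
    proof (cases "n \<ge> 2")
      case True
      \<comment> \<open>Stationarity controls only the real part; as all coefficients are real, the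
        full identity follows.\<close>
      have "taylor_coeff (\<lambda>z. (1 - z\<^sup>2) * deriv u z) n
        - 2 * of_real A * taylor_coeff u n - 2 * of_real B * taylor_coeff v n \<in> \<real>"
        unfolding L by (intro Reals_diff Reals_mult real) auto
      then have "taylor_coeff (\<lambda>z. (1 - z\<^sup>2) * deriv u z) n
        - 2 * of_real A * taylor_coeff u n - 2 * of_real B * taylor_coeff v n = 0"
        using eq[OF True] by (metis complex_is_Real_iff complex_eq_iff zero_complex.sel)
      then show ?thesis unfolding R using True by (simp add: algebra_simps)
    next
      case False
      \<comment> \<open>Here no extremality enters: index 0 compares the linear coefficient of
        \<open>u\<close> with \<open>c\<close>, and index 1 holds because A and B are the second
        coefficients.\<close>
      then have "n = 0 \<or> n = 1" by auto
      then show ?thesis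
        unfolding L R using low u2 c by (auto simp: numeral_2_eq_2)
    qed
  qed (use z in auto)
  have relh: "Re (taylor_coeff (\<lambda>z. (1 - z\<^sup>2) * deriv h0 z) n - 2 * of_real A * taylor_coeff h0 n
        - 2 * of_real B * taylor_coeff g0 n) = 0"
    and relg: "Re (taylor_coeff (\<lambda>z. (1 - z\<^sup>2) * deriv g0 z) n - 2 * of_real A * taylor_coeff g0 n
        - 2 * of_real B * taylor_coeff h0 n) = 0" if "n \<ge> 2" for n
    using extremal_coeff_relation[OF F hg0 ret, of n] hmax[OF that] gmax[OF that] that
    unfolding A B by auto
  have odeh: "(1 - z\<^sup>2) * deriv h0 z = 1 + 2 * of_real A * h0 z + 2 * of_real B * g0 z"
    if "z \<in> unit_disk" for z
    using system[OF that D(1,2), of 1] low A re relh by simp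
  have odeg: "(1 - z\<^sup>2) * deriv g0 z = 2 * of_real A * g0 z + 2 * of_real B * h0 z"
    if "z \<in> unit_disk" for z
    using system[OF that D(2,1), of 0] low B re relg by simp
  have sp: "deriv h0 z \<noteq> 0" "norm (deriv g0 z / deriv h0 z) < 1" if "z \<in> unit_disk" for z
    using D(6) that by (auto simp: sense_preserving_def)
  have sol: "h0 z - g0 z = gen_koebe (of_real A - of_real B) z"
    "exp (2 * of_real B * half_plane_log z) + 1 \<noteq> 0"
    "deriv g0 z / deriv h0 z =
      (exp (2 * of_real B * half_plane_log z) - 1) / (exp (2 * of_real B * half_plane_log z) + 1)"
    if z: "z \<in> unit_disk" for z
    by (rule koebe_system_dilatation[OF D(1-4) odeh odeg z]; (assumption | rule sp(1)[OF z]))+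
  have "2 * B \<le> 1"
  proof (rule dilatation_exponent_le_1)
    fix z assume z: "z \<in> unit_disk"
    show "exp (of_real (2 * B) * half_plane_log z) + 1 \<noteq> 0 \<and>
      norm ((exp (of_real (2 * B) * half_plane_log z) - 1) / (exp (of_real (2 * B) * half_plane_log z) + 1)) < 1"
      using sol(2,3)[OF z] sp[OF z] by simp
  qed
  \<comment> \<open>The scalar equation for \<open>h0 - g0\<close> has parameter A - B and the
    dilatation has exponent 2 B; the sum of the two is A + B, the order found above.\<close>
  moreover have "is_gen_harmonic_koebe (A - B) (2 * B) f0"
    unfolding is_gen_harmonic_koebe_def
  proof (rule exI[of _ h0], rule exI[of _ g0], intro conjI ballI)
    fix z assume z: "z \<in> unit_disk"
    show "h0 z - g0 z = gen_koebe (of_real (A - B)) z" using sol(1)[OF z] by simp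
    show "deriv h0 z \<noteq> 0" by (rule sp(1)[OF z])
    show "deriv g0 z / deriv h0 z = lens_map (2 * B) z"
      using sol(3)[OF z] by (simp add: lens_map_eq[OF z])
    show "f0 z = h0 z + cnj (g0 z)" using assms(3) z by (simp add: harmonic_repr_def)
  qed (use D in auto)
  moreover have "family_order F = ereal ((A - B) + 2 * B)" using order by simp
  ultimately show ?thesis using \<open>B \<ge> 0\<close> by (intro exI[of _ "A - B"] exI[of _ "2 * B"]) auto
qed

end
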